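(* Let $F$ be a tract with a fixed involution and let $M_1,\dots,M_s$ be $F$-matroids on $E=\{1,\dots,n\}$. Consider: (1) $\mathcal{V}^*(M_1)\subseteq\dots\subseteq\mathcal{V}^*(M_s)$; (2) $(M_1,\dots,M_s)$ is a flag $F$-matroid, i.e. $M_j\twoheadrightarrow M_i$ for all $1\le i<j\le s$; (3) $M_{i+1}\twoheadrightarrow M_i$ for all $1\le i\le s-1$. Then (1) implies (2) and (2) implies (3) for every tract $F$, and (3) implies (1) if $F$ is perfect.
   Context: A tract is a commutative multiplicative monoid $F$ with identity $1$ and absorbing element $0$ such that $F^\times=F\setminus\{0\}$ is a group, together with a subset $N_F\subseteq\mathbb{N}[F^\times]$ (the nullset) such that $0\in N_F$, $1\notin N_F$, there is a unique $\epsilon\in F^\times$ with $1+\epsilon\in N_F$, and $N_F$ is stable under multiplication by $F^\times$. An involution is a tract morphism $\tau:F\to F$ with $\tau^2=\mathrm{id}$; $\overline x=\tau(x)$. A Grassmann–Plücker function of rank $r$ on $E$ is a map $\varphi:E^r\to F$, not identically zero, alternating (swapping two arguments multiplies the value by $\epsilon$; value $0$ if two arguments coincide), with $\sum_{k=1}^{r+1}\epsilon^k\varphi(y_1,\dots,\widehat{y_k},\dots,y_{r+1})\varphi(y_k,x_1,\dots,x_{r-1})\in N_F$ for all $x_i,y_j\in E$. An $F$-matroid $M$ of rank $r$ is a class $[\varphi]$ modulo multiplication by $F^\times$; $\underline M$ has as bases the sets $\{x_1,\dots,x_r\}$ with $\varphi(x_1,\dots,x_r)\ne0$. If $M=[\mu]$,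 $N=[\nu]$ have ranks $r,w$, then $N\twoheadrightarrow M$ means $\sum_{k=1}^{w+1}\epsilon^k\nu(y_1,\dots,\widehat{y_k},\dots,y_{w+1})\mu(y_k,x_1,\dots,x_{r-1})\in N_F$ for all $y_1,\dots,y_{w+1},x_1,\dots,x_{r-1}\in E$. Circuits: for each circuit $C$ of $\underline M$ choose $y_0\in C$ and a basis $\{y_1,\dots,y_r\}$ of $\underline M$ containing $C\setminus\{y_0\}$; set $X_C(y_i)=\epsilon^i\varphi(y_0,\dots,\widehat{y_i},\dots,y_r)$, $X_C(y)=0$ otherwise; $\mathcal{C}(M)=\{aX_C:a\in F^\times\}$. Dual $M^*$: represented by $\varphi^*(x_1,\dots,x_{n-r})=\mathrm{sign}(x_1,\dots,x_{n-r},x'_1,\dots,x'_r)\overline{\varphi(x'_1,\dots,x'_r)}$ for $E=\{x_1,\dots,x_{n-r},x'_1,\dots,x'_r\}$ (sign of the sorting permutation, $-1$ read as $\epsilon$). $\mathcal{C}^*(M)=\mathcal{C}(M^* )$. For $X,Y\in F^E$, $X\perp Y$ iff $\sum_iX_i\overline{Y_i}\in N_F$; $\mathcal X^\perp$ is the set of elements orthogonal to all of $\mathcal X$. Vectors $\mathcal V(M)=\mathcal C^*(M)^\perp$, covectors $\mathcal V^*(M)=\mathcal C(M)^\perp$. $F$ is perfect if $V\perp W$ for all $V\in\mathcal V(M)$, $W\in\mathcal V^*(M)$, for every $F$-matroid $M$. *)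

theory Defs
  imports Complex_Main "HOL-Library.Multiset" "HOL-Combinatorics.Permutations"
begin

section \<open>Tracts\<close>

text \<open>
  An element of \<open>\<nat>[F\<^sup>\<times>]\<close> is a finite multiset of nonzero elements; the zero of \<open>\<nat>[F\<^sup>\<times>]\<close> is
  the empty multiset.  The nonzero elements form a group because \<open>0 \<noteq> 1\<close> and every nonzero
  element is invertible.
\<close>

class tract = comm_monoid_mult + mult_zero + zero_neq_one +
  fixes nullset :: "'a multiset set"
  assumes ex_inverse: "x \<noteq> 0 \<Longrightarrow> \<exists>y. x * y = 1"
    and nullset_nonzero: "A \<in> nullset \<Longrightarrow> 0 \<notin># A"
    and empty_in_nullset: "{#} \<in> nullset"
    and one_notin_nullset: "{#1#} \<notin> nullset"
    and ex1_eps: "\<exists>!e. e \<noteq> 0 \<and> {#1, e#} \<in> nullset"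
    and nullset_scale: "a \<noteq> 0 \<Longrightarrow> A \<in> nullset \<Longrightarrow> image_mset ((*) a) A \<in> nullset"

definition eps :: "'a::tract" where
  "eps = (THE e. e \<noteq> 0 \<and> {#1, e#} \<in> nullset)"

text \<open>The formal sum of a family of elements of \<open>F\<close>; the element \<open>0\<close> of \<open>F\<close> contributes nothing.\<close>

definition fsum :: "('i \<Rightarrow> 'a::tract) \<Rightarrow> 'i set \<Rightarrow> 'a multiset" where
  "fsum f I = filter_mset (\<lambda>x. x \<noteq> 0) (image_mset f (mset_set I))"

definition tract_morphism :: "('a::tract \<Rightarrow> 'b::tract) \<Rightarrow> bool" where
  "tract_morphism f \<longleftrightarrow> f 0 = 0 \<and> f 1 = 1 \<and> (\<forall>x y. f (x * y) = f x * f y) \<and>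
     (\<forall>A\<in>nullset. image_mset f A \<in> nullset)"

definition tract_involution :: "('a::tract \<Rightarrow> 'a) \<Rightarrow> bool" where
  "tract_involution \<tau> \<longleftrightarrow> tract_morphism \<tau> \<and> (\<forall>x. \<tau> (\<tau> x) = x)"


section \<open>Grassmann--Pluecker functions and matroids over a tract\<close>

definition tuples :: "nat \<Rightarrow> nat \<Rightarrow> nat list set" where
  "tuples n r = {xs. length xs = r \<and> set xs \<subseteq> {1..n}}"

definition del_nth :: "nat \<Rightarrow> 'b list \<Rightarrow> 'b list" where
  "del_nth i xs = take i xs @ drop (Suc i) xs"

text \<open>The list \<open>ys = [y\<^sub>1, y\<^sub>2, \<dots>]\<close> is indexed from \<open>0\<close>, so \<open>y\<^sub>k\<close> is \<open>ys ! (k - 1)\<close>.\<close>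

definition plucker_sum ::
  "(nat list \<Rightarrow> 'a::tract) \<Rightarrow> (nat list \<Rightarrow> 'a) \<Rightarrow> nat list \<Rightarrow> nat list \<Rightarrow> 'a multiset" where
  "plucker_sum \<nu> \<mu> ys xs =
     fsum (\<lambda>k. eps ^ k * \<nu> (del_nth (k - 1) ys) * \<mu> (ys ! (k - 1) # xs)) {1..length ys}"

text \<open>
  A map on \<open>E\<^sup>r\<close>, \<open>E = {1..n}\<close>, is encoded as a function on lists that is \<open>0\<close> on every list
  outside \<open>E\<^sup>r\<close>.  For \<open>r = 0\<close> there is no tuple of length \<open>r - 1\<close>, and no relation is imposed.
\<close>

definition gp_function :: "nat \<Rightarrow> nat \<Rightarrow> (nat list \<Rightarrow> 'a::tract) \<Rightarrow> bool" where
  "gp_function n r \<phi> \<longleftrightarrow>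
     (\<forall>xs. xs \<notin> tuples n r \<longrightarrow> \<phi> xs = 0) \<and>
     (\<exists>xs\<in>tuples n r. \<phi> xs \<noteq> 0) \<and>
     (\<forall>xs\<in>tuples n r. \<forall>i j. i < j \<and> j < r \<longrightarrow> \<phi> (xs[i := xs ! j, j := xs ! i]) = eps * \<phi> xs) \<and>
     (\<forall>xs\<in>tuples n r. \<not> distinct xs \<longrightarrow> \<phi> xs = 0) \<and>
     (\<forall>ys\<in>tuples n (Suc r). \<forall>xs. Suc (length xs) = r \<and> set xs \<subseteq> {1..n} \<longrightarrow>
        plucker_sum \<phi> \<phi> ys xs \<in> nullset)"

definition gp_class :: "(nat list \<Rightarrow> 'a::tract) \<Rightarrow> (nat list \<Rightarrow> 'a) set" where
  "gp_class \<phi> = {\<lambda>xs. a * \<phi> xs | a. a \<noteq> 0}"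

definition F_matroid :: "nat \<Rightarrow> (nat list \<Rightarrow> 'a::tract) set \<Rightarrow> bool" where
  "F_matroid n M \<longleftrightarrow> (\<exists>r \<phi>. gp_function n r \<phi> \<and> M = gp_class \<phi>)"

definition mrank :: "(nat list \<Rightarrow> 'a::tract) set \<Rightarrow> nat" where
  "mrank M = (THE r. \<exists>\<phi>\<in>M. \<exists>xs. \<phi> xs \<noteq> 0 \<and> length xs = r)"

text \<open>\<open>F_quotient n N M\<close> is the relation \<open>N ->> M\<close>.\<close>

definition F_quotient ::
  "nat \<Rightarrow> (nat list \<Rightarrow> 'a::tract) set \<Rightarrow> (nat list \<Rightarrow> 'a) set \<Rightarrow> bool" where
  "F_quotient n N M \<longleftrightarrow>
     (\<forall>\<nu>\<in>N. \<forall>\<mu>\<in>M. \<forall>ys\<in>tuples n (Suc (mrank N)). \<forall>xs.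
        Suc (length xs) = mrank M \<and> set xs \<subseteq> {1..n} \<longrightarrow> plucker_sum \<nu> \<mu> ys xs \<in> nullset)"


section \<open>Circuits, duality, vectors and covectors\<close>

definition bases :: "(nat list \<Rightarrow> 'a::tract) \<Rightarrow> nat set set" where
  "bases \<phi> = {set xs | xs. \<phi> xs \<noteq> 0}"

definition indep :: "(nat list \<Rightarrow> 'a::tract) \<Rightarrow> nat set \<Rightarrow> bool" where
  "indep \<phi> A \<longleftrightarrow> (\<exists>B\<in>bases \<phi>. A \<subseteq> B)"

definition circuit :: "nat \<Rightarrow> (nat list \<Rightarrow> 'a::tract) \<Rightarrow> nat set \<Rightarrow> bool" where
  "circuit n \<phi> C \<longleftrightarrow> C \<subseteq> {1..n} \<and> \<not> indep \<phi> C \<and> (\<forall>D. D \<subset> C \<longrightarrow> indep \<phi> D)"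

text \<open>
  \<open>circuit_vector \<phi> C X\<close>: the vector \<open>X\<close> is obtained from the circuit \<open>C\<close> by some admissible
  choice of \<open>y\<^sub>0\<close> and \<open>[y\<^sub>1, \<dots>, y\<^sub>r]\<close>.  All choices are allowed; by lemma
  \<open>circuit_vector_unique\<close> below they give the same vector up to a nonzero factor.
  Elements of \<open>F\<^sup>E\<close> are encoded as functions vanishing outside \<open>E\<close>.
\<close>

definition circuit_vector ::
  "(nat list \<Rightarrow> 'a::tract) \<Rightarrow> nat set \<Rightarrow> (nat \<Rightarrow> 'a) \<Rightarrow> bool" where
  "circuit_vector \<phi> C X \<longleftrightarrow>
     (\<exists>y0 ys. y0 \<in> C \<and> distinct ys \<and> set ys \<in> bases \<phi> \<and> C - {y0} \<subseteq> set ys \<and>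
        (\<forall>i\<le>length ys. X ((y0 # ys) ! i) = eps ^ i * \<phi> (del_nth i (y0 # ys))) \<and>
        (\<forall>y. y \<notin> set (y0 # ys) \<longrightarrow> X y = 0))"

definition F_circuits :: "nat \<Rightarrow> (nat list \<Rightarrow> 'a::tract) set \<Rightarrow> (nat \<Rightarrow> 'a) set" where
  "F_circuits n M =
     {\<lambda>i. a * X i | a X. a \<noteq> 0 \<and> (\<exists>\<phi>\<in>M. \<exists>C. circuit n \<phi> C \<and> circuit_vector \<phi> C X)}"

text \<open>
  A list \<open>zs\<close> enumerating \<open>{1..n}\<close> is read as the permutation \<open>i \<mapsto> z\<^sub>i\<close>; the permutation
  sorting \<open>zs\<close> is its inverse and has the same sign.
\<close>

definition tuple_sign :: "nat list \<Rightarrow> 'a::tract" where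
  "tuple_sign zs =
     (if sign (\<lambda>i. if i \<in> {1..length zs} then zs ! (i - 1) else i) = 1 then 1 else eps)"

text \<open>
  The complement of \<open>xs\<close> is enumerated increasingly; another order changes the sign and the value
  of \<open>\<phi>\<close> by the same power of \<open>eps\<close>.  If the length of \<open>xs\<close> is not \<open>n - r\<close>, then the argument of
  \<open>\<phi>\<close> is not an \<open>r\<close>-tuple and the value is \<open>0\<close>.
\<close>

definition dual_gp ::
  "('a::tract \<Rightarrow> 'a) \<Rightarrow> nat \<Rightarrow> (nat list \<Rightarrow> 'a) \<Rightarrow> nat list \<Rightarrow> 'a" where
  "dual_gp \<tau> n \<phi> xs =
     (if distinct xs \<and> set xs \<subseteq> {1..n}
      then let xs' = sorted_list_of_set ({1..n} - set xs) in tuple_sign (xs @ xs') * \<tau> (\<phi> xs')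
      else 0)"

definition F_dual ::
  "('a::tract \<Rightarrow> 'a) \<Rightarrow> nat \<Rightarrow> (nat list \<Rightarrow> 'a) set \<Rightarrow> (nat list \<Rightarrow> 'a) set" where
  "F_dual \<tau> n M = (\<Union>\<phi>\<in>M. gp_class (dual_gp \<tau> n \<phi>))"

definition F_cocircuits ::
  "('a::tract \<Rightarrow> 'a) \<Rightarrow> nat \<Rightarrow> (nat list \<Rightarrow> 'a) set \<Rightarrow> (nat \<Rightarrow> 'a) set" where
  "F_cocircuits \<tau> n M = F_circuits n (F_dual \<tau> n M)"

definition orth :: "('a::tract \<Rightarrow> 'a) \<Rightarrow> nat \<Rightarrow> (nat \<Rightarrow> 'a) \<Rightarrow> (nat \<Rightarrow> 'a) \<Rightarrow> bool" where
  "orth \<tau> n X Y \<longleftrightarrow> fsum (\<lambda>i. X i * \<tau> (Y i)) {1..n} \<in> nullset"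

definition perp :: "('a::tract \<Rightarrow> 'a) \<Rightarrow> nat \<Rightarrow> (nat \<Rightarrow> 'a) set \<Rightarrow> (nat \<Rightarrow> 'a) set" where
  "perp \<tau> n S = {Y. (\<forall>i. i \<notin> {1..n} \<longrightarrow> Y i = 0) \<and> (\<forall>X\<in>S. orth \<tau> n Y X)}"

definition F_vectors ::
  "('a::tract \<Rightarrow> 'a) \<Rightarrow> nat \<Rightarrow> (nat list \<Rightarrow> 'a) set \<Rightarrow> (nat \<Rightarrow> 'a) set" where
  "F_vectors \<tau> n M = perp \<tau> n (F_cocircuits \<tau> n M)"

definition F_covectors ::
  "('a::tract \<Rightarrow> 'a) \<Rightarrow> nat \<Rightarrow> (nat list \<Rightarrow> 'a) set \<Rightarrow> (nat \<Rightarrow> 'a) set" where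
  "F_covectors \<tau> n M = perp \<tau> n (F_circuits n M)"

definition perfect_tract :: "('a::tract \<Rightarrow> 'a) \<Rightarrow> bool" where
  "perfect_tract \<tau> \<longleftrightarrow>
     (\<forall>n M. F_matroid n M \<longrightarrow> (\<forall>V\<in>F_vectors \<tau> n M. \<forall>W\<in>F_covectors \<tau> n M. orth \<tau> n V W))"


section \<open>Well-definedness of rank and circuit vectors\<close>

lemma eps_props: "(eps::'a::tract) \<noteq> 0" "{#1, eps::'a#} \<in> nullset"
proof -
  have "(eps::'a) \<noteq> 0 \<and> {#1, eps::'a#} \<in> nullset"
    unfolding eps_def by (rule theI') (rule ex1_eps)
  then show "(eps::'a) \<noteq> 0" "{#1, eps::'a#} \<in> nullset" by auto
qed

lemma eps_unique: "e \<noteq> 0 \<Longrightarrow> {#1, e#} \<in> nullset \<Longrightarrow> e = (eps::'a::tract)"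
  using ex1_eps eps_props by blast

lemma mult_nonzero: "(a::'a::tract) \<noteq> 0 \<Longrightarrow> b \<noteq> 0 \<Longrightarrow> a * b \<noteq> 0"
proof
  assume a: "a \<noteq> 0" and b: "b \<noteq> 0" and ab: "a * b = 0"
  obtain y where y: "a * y = 1" using ex_inverse[OF a] by blast
  have "b = (a * y) * b" by (simp add: y)
  also have "\<dots> = y * (a * b)" by (simp add: mult_ac)
  finally show False using ab b by simp
qed

lemma mult_eq_0: "(a::'a::tract) * b = 0 \<longleftrightarrow> a = 0 \<or> b = 0"
  using mult_nonzero by auto

lemma power_eq_0: "(a::'a::tract) \<noteq> 0 \<Longrightarrow> a ^ k \<noteq> 0"
  by (induction k) (auto simp: mult_eq_0)

lemma mult_cancel: "(a::'a::tract) \<noteq> 0 \<Longrightarrow> a * b = a * c \<longleftrightarrow> b = c"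
  by (metis ex_inverse mult.assoc mult.commute mult_1)

lemma pair_in_nullset:
  assumes "{#a, b#} \<in> nullset" "(a::'a::tract) \<noteq> 0"
  shows "b = eps * a"
proof -
  obtain y where y: "a * y = 1" using ex_inverse[OF assms(2)] by blast
  then have y0: "y \<noteq> 0" by (metis mult_zero_right zero_neq_one)
  have "{#1, y * b#} \<in> nullset"
    using nullset_scale[OF y0 assms(1)] y by (simp add: mult.commute)
  moreover have "b \<noteq> 0" using nullset_nonzero[OF assms(1)] by auto
  ultimately have "y * b = eps" using eps_unique y0 mult_nonzero by blast
  then have "a * y * b = eps * a" by (metis mult.assoc mult.commute)
  then show ?thesis by (simp add: y)
qed

lemma singleton_notin_nullset: "(a::'a::tract) \<noteq> 0 \<Longrightarrow> {#a#} \<notin> nullset"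
proof
  assume a: "a \<noteq> 0" and n: "{#a#} \<in> nullset"
  obtain y where y: "a * y = 1" using ex_inverse[OF a] by blast
  then have y0: "y \<noteq> 0" by (metis mult_zero_right zero_neq_one)
  have "{#1::'a#} \<in> nullset" using nullset_scale[OF y0 n] y by (simp add: mult.commute)
  then show False using one_notin_nullset by blast
qed

lemma fsum_two:
  assumes "finite I" "p \<in> I" "q \<in> I" "p \<noteq> q" "\<And>i. i \<in> I \<Longrightarrow> i \<noteq> p \<Longrightarrow> i \<noteq> q \<Longrightarrow> f i = 0"
    and "fsum f I \<in> nullset" and p: "f p \<noteq> (0::'a::tract)"
  shows "f q = eps * f p"
proof -
  have I: "mset_set I = mset_set (I - {p, q}) + {#p, q#}"
  proof -
    have "I = insert p (insert q (I - {p, q}))" using assms by auto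
    then have "mset_set I = mset_set (insert p (insert q (I - {p, q})))" by simp
    also have "\<dots> = mset_set (I - {p, q}) + {#p, q#}"
      using assms(1,4) by (subst mset_set.insert; simp)+
    finally show ?thesis .
  qed
  have "filter_mset (\<lambda>x. x \<noteq> 0) (image_mset f (mset_set (I - {p, q}))) = {#}"
    using assms(1,5) by (intro multiset_eqI) (auto simp: count_eq_zero_iff)
  then have e: "fsum f I = filter_mset (\<lambda>x. x \<noteq> 0) {#f p, f q#}"
    unfolding fsum_def I by simp
  show ?thesis
  proof (cases "f q = 0")
    case True
    then show ?thesis using e p assms(6) singleton_notin_nullset[OF p] by simp
  next
    case False
    then have "{#f p, f q#} \<in> nullset" using e p assms(6) by simp
    then show ?thesis using pair_in_nullset p by blast
  qed
qed

lemma gp_support: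
  assumes "gp_function n r \<phi>" "\<phi> xs \<noteq> 0"
  shows "length xs = r" "set xs \<subseteq> {1..n}" "distinct xs"
  using assms unfolding gp_function_def tuples_def by blast+

lemma gp_swap:
  assumes "gp_function n r \<phi>" "xs \<in> tuples n r" "i < j" "j < r"
  shows "\<phi> (xs[i := xs ! j, j := xs ! i]) = eps * \<phi> xs"
  using assms unfolding gp_function_def by simp

lemma gp_relation:
  assumes "gp_function n r \<phi>" "ys \<in> tuples n (Suc r)" "Suc (length xs) = r" "set xs \<subseteq> {1..n}"
  shows "plucker_sum \<phi> \<phi> ys xs \<in> nullset"
  using assms unfolding gp_function_def by simp

lemma mrank_gp_class:
  assumes "gp_function n r \<phi>"
  shows "mrank (gp_class \<phi>) = r"
  unfolding mrank_def
proof (rule the_equality)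
  obtain xs where xs: "\<phi> xs \<noteq> 0" using assms unfolding gp_function_def by blast
  have "\<phi> \<in> gp_class \<phi>" unfolding gp_class_def using zero_neq_one by (auto intro!: exI[of _ 1])
  then show "\<exists>\<phi>\<in>gp_class \<phi>. \<exists>xs. \<phi> xs \<noteq> 0 \<and> length xs = r"
    using xs gp_support(1)[OF assms xs] by blast
next
  fix r' assume "\<exists>\<psi>\<in>gp_class \<phi>. \<exists>xs. \<psi> xs \<noteq> 0 \<and> length xs = r'"
  then show "r' = r" using gp_support(1)[OF assms] unfolding gp_class_def
    by (auto simp: mult_eq_0)
qed

lemma basis_front:
  assumes "gp_function n r \<phi>" "B \<in> bases \<phi>" "c \<in> B"
  obtains xs where "\<phi> (c # xs) \<noteq> 0" "set (c # xs) = B"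
proof -
  obtain zs where zs: "\<phi> zs \<noteq> 0" "set zs = B" using assms(2) unfolding bases_def by blast
  obtain j where j: "j < length zs" "zs ! j = c" using assms(3) zs(2) by (metis in_set_conv_nth)
  show thesis
  proof (cases "j = 0")
    case True
    then obtain xs where "zs = c # xs" using j by (cases zs) auto
    then show ?thesis using that zs by blast
  next
    case False
    define ws where "ws = zs[0 := zs ! j, j := zs ! 0]"
    have "zs \<in> tuples n r" "length zs = r"
      using gp_support[OF assms(1) zs(1)] by (auto simp: tuples_def)
    then have "\<phi> ws = eps * \<phi> zs"
      using gp_swap[OF assms(1)] j False unfolding ws_def by auto
    then have w: "\<phi> ws \<noteq> 0" using zs(1) eps_props(1) mult_nonzero by metis
    have "mset ws = mset zs" unfolding ws_def using j by (intro mset_swap) auto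
    then have s: "set ws = B" using zs(2) by (metis set_mset_mset)
    have z0: "zs \<noteq> []" using j(1) by auto
    have "ws ! 0 = zs[0 := zs ! j] ! 0" unfolding ws_def using False by simp
    also have "\<dots> = c" using z0 j(2) nth_list_update_eq[of 0 zs] by simp
    finally have "ws ! 0 = c" .
    moreover have "ws \<noteq> []" using z0 unfolding ws_def by simp
    ultimately obtain xs where "ws = c # xs" by (cases ws) auto
    then show ?thesis using that w s by blast
  qed
qed

lemma circuit_vector_off:
  assumes gp: "gp_function n r \<phi>" and C: "circuit n \<phi> C" and X: "circuit_vector \<phi> C X"
    and y: "y \<notin> C"
  shows "X y = 0"
proof -
  obtain y0 ys where ys: "y0 \<in> C" "distinct ys" "set ys \<in> bases \<phi>" "C - {y0} \<subseteq> set ys"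
    "\<And>i. i \<le> length ys \<Longrightarrow> X ((y0 # ys) ! i) = eps ^ i * \<phi> (del_nth i (y0 # ys))"
    "\<And>y. y \<notin> set (y0 # ys) \<Longrightarrow> X y = 0"
    using X unfolding circuit_vector_def by blast
  show ?thesis
  proof (cases "y \<in> set (y0 # ys)")
    case False
    then show ?thesis using ys(6) by blast
  next
    case True
    then obtain i where i: "i < length (y0 # ys)" "(y0 # ys) ! i = y" by (metis in_set_conv_nth)
    have "C \<subseteq> set (del_nth i (y0 # ys))"
    proof
      fix c assume c: "c \<in> C"
      then have "c \<in> set (y0 # ys)" using ys(4) by auto
      moreover have "c \<noteq> y" using c y by blast
      moreover have "y0 # ys = take i (y0 # ys) @ y # drop (Suc i) (y0 # ys)"
        using i id_take_nth_drop by metis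
      ultimately show "c \<in> set (del_nth i (y0 # ys))" unfolding del_nth_def
        by (metis Un_iff set_ConsD set_append)
    qed
    then have "\<phi> (del_nth i (y0 # ys)) = 0"
      using C unfolding circuit_def indep_def bases_def by blast
    then show ?thesis using ys(5)[of i] i by simp
  qed
qed

lemma circuit_vector_relation:
  fixes \<phi> :: "nat list \<Rightarrow> 'a::tract"
  assumes gp: "gp_function n r \<phi>" and C: "circuit n \<phi> C" and X: "circuit_vector \<phi> C X"
    and cd: "c \<in> C" "d \<in> C" "c \<noteq> d"
    and xs: "\<phi> (c # xs) \<noteq> 0" "C - {d} \<subseteq> set (c # xs)"
    and nz: "X c \<noteq> 0"
  shows "X d * \<phi> (d # xs) = eps * (X c * \<phi> (c # xs))"
proof -
  obtain y0 ys where ys: "y0 \<in> C" "distinct ys" "set ys \<in> bases \<phi>" "C - {y0} \<subseteq> set ys"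
    "\<And>i. i \<le> length ys \<Longrightarrow> X ((y0 # ys) ! i) = eps ^ i * \<phi> (del_nth i (y0 # ys))"
    "\<And>y. y \<notin> set (y0 # ys) \<Longrightarrow> X y = 0"
    using X unfolding circuit_vector_def by blast
  let ?l = "y0 # ys"
  have y0: "y0 \<notin> set ys"
    using C ys unfolding circuit_def indep_def by blast
  obtain zs where zs: "\<phi> zs \<noteq> 0" "set zs = set ys" using ys(3) unfolding bases_def by blast
  have lys: "length ys = r"
    using gp_support[OF gp zs(1)] zs(2) ys(2) distinct_card by metis
  have "C \<subseteq> {1..n}" using C unfolding circuit_def by (rule conjunct1)
  then have "y0 \<in> {1..n}" using ys(1) by (rule subsetD)
  moreover have "set ys \<subseteq> {1..n}" using gp_support(2)[OF gp zs(1)] zs(2) by simp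
  ultimately have t: "?l \<in> tuples n (Suc r)" using lys by (simp add: tuples_def)
  have sx: "Suc (length xs) = r" "set xs \<subseteq> {1..n}" "distinct (c # xs)"
    using gp_support[OF gp xs(1)] by auto
  let ?f = "\<lambda>k. eps ^ k * \<phi> (del_nth (k - 1) ?l) * \<phi> (?l ! (k - 1) # xs)"
  have N: "fsum ?f {1..length ?l} \<in> nullset"
    using gp_relation[OF gp t sx(1,2)] unfolding plucker_sum_def .
  have f: "?f k = eps * (X (?l ! (k - 1)) * \<phi> (?l ! (k - 1) # xs))" if "k \<in> {1..length ?l}" for k
  proof -
    have "(eps::'a) ^ k = eps * eps ^ (k - 1)" using that by (cases k) auto
    moreover have "X (?l ! (k - 1)) = eps ^ (k - 1) * \<phi> (del_nth (k - 1) ?l)"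
      using ys(5)[of "k - 1"] that by auto
    ultimately show ?thesis by (simp only: mult.assoc)
  qed
  have dl: "distinct ?l" using y0 ys(2) by simp
  have "c \<in> set ?l" "d \<in> set ?l" using ys(4) cd by auto
  then obtain i j where ij: "i < length ?l" "?l ! i = c" "j < length ?l" "?l ! j = d"
    by (metis in_set_conv_nth)
  have z: "?f k = 0" if k: "k \<in> {1..length ?l}" "k \<noteq> Suc i" "k \<noteq> Suc j" for k
  proof -
    let ?y = "?l ! (k - 1)"
    have "k - 1 \<noteq> i" "k - 1 \<noteq> j" "k - 1 < length ?l" using k by auto
    then have "?y \<noteq> c" "?y \<noteq> d" using ij dl nth_eq_iff_index_eq by metis+
    show ?thesis
    proof (cases "?y \<in> C")
      case True
      then have "?y \<in> set xs" using xs(2) \<open>?y \<noteq> c\<close> \<open>?y \<noteq> d\<close> by auto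
      then have "\<phi> (?y # xs) = 0" using gp_support(3)[OF gp, of "?y # xs"] by auto
      then show ?thesis using f k(1) by simp
    next
      case False
      then show ?thesis using f k(1) circuit_vector_off[OF gp C X] by simp
    qed
  qed
  have "i \<noteq> j" using ij cd by auto
  have fi: "?f (Suc i) = eps * (X c * \<phi> (c # xs))" using f[of "Suc i"] ij by auto
  have fj: "?f (Suc j) = eps * (X d * \<phi> (d # xs))" using f[of "Suc j"] ij by auto
  have "?f (Suc i) \<noteq> 0" unfolding fi using eps_props(1) nz xs(1) mult_nonzero by blast
  then have "?f (Suc j) = eps * ?f (Suc i)"
    using fsum_two[of "{1..length ?l}" "Suc i" "Suc j" ?f] N z ij \<open>i \<noteq> j\<close> by auto
  then show ?thesis unfolding fi fj using mult_cancel[OF eps_props(1)] by metis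
qed

lemma gp_perm:
  assumes gp: "gp_function n r \<phi>" and zs: "\<phi> zs \<noteq> 0" and "distinct ys" "set ys = set zs"
  shows "\<phi> ys \<noteq> 0"
proof -
  have l: "length zs = r" "set zs \<subseteq> {1..n}" "distinct zs" using gp_support[OF gp zs] by auto
  have "mset ys = mset zs" using assms(3,4) l(3) set_eq_iff_mset_eq_distinct by blast
  then obtain p where p: "p permutes {..<length zs}" "permute_list p zs = ys"
    by (metis mset_eq_permutation)
  have "\<phi> (permute_list p zs) \<noteq> 0"
    using finite_lessThan p(1)
  proof (induct rule: permutes_rev_induct)
    case id
    show ?case by (simp add: zs)
  next
    case (swap a b p)
    define ws where "ws = permute_list p zs"
    have lw: "length ws = r" unfolding ws_def by (simp add: l)
    have ab: "a < r" "b < r" using swap l by auto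
    have w0: "\<phi> ws \<noteq> 0" using swap unfolding ws_def by blast
    have t: "ws \<in> tuples n r" using gp_support[OF gp w0] unfolding tuples_def by auto
    have tr: "transpose a b permutes {..<length zs}"
      using ab l(1) by (intro permutes_swap_id) auto
    let ?i = "min a b" and ?j = "max a b"
    have "permute_list (p \<circ> transpose a b) zs = permute_list (transpose a b) ws"
      unfolding ws_def using tr by (rule permute_list_compose)
    also have "\<dots> = ws[?i := ws ! ?j, ?j := ws ! ?i]"
    proof (rule nth_equalityI)
      fix i assume "i < length (permute_list (transpose a b) ws)"
      then show "permute_list (transpose a b) ws ! i = ws[?i := ws ! ?j, ?j := ws ! ?i] ! i"
        using ab lw by (simp add: permute_list_def nth_list_update transpose_def min_def max_def)
    qed simp
    finally have e: "permute_list (p \<circ> transpose a b) zs = ws[?i := ws ! ?j, ?j := ws ! ?i]" .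
    have "?i < ?j" "?j < r" using swap(3) ab by auto
    then have "\<phi> (ws[?i := ws ! ?j, ?j := ws ! ?i]) = eps * \<phi> ws"
      using gp_swap[OF gp t] by blast
    then show ?case unfolding e using w0 eps_props(1) mult_nonzero by metis
  qed
  then show ?thesis using p(2) by simp
qed

lemma circuit_minus_indep:
  assumes "circuit n \<phi> C" "d \<in> C"
  obtains B where "B \<in> bases \<phi>" "C - {d} \<subseteq> B"
proof -
  have "C - {d} \<subset> C" using assms(2) by auto
  moreover have "\<forall>D. D \<subset> C \<longrightarrow> indep \<phi> D" using assms(1) unfolding circuit_def by simp
  ultimately have "indep \<phi> (C - {d})" by simp
  then show thesis using that unfolding indep_def by auto
qed

lemma circuit_vector_nonzero:
  assumes gp: "gp_function n r \<phi>" and C: "circuit n \<phi> C" and X: "circuit_vector \<phi> C X"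
  shows "d \<in> C \<Longrightarrow> X d \<noteq> 0"
proof -
  assume d: "d \<in> C"
  obtain y0 ys where ys: "y0 \<in> C" "distinct ys" "set ys \<in> bases \<phi>"
    "\<And>i. i \<le> length ys \<Longrightarrow> X ((y0 # ys) ! i) = eps ^ i * \<phi> (del_nth i (y0 # ys))"
    using X unfolding circuit_vector_def by blast
  obtain zs where zs: "\<phi> zs \<noteq> 0" "set ys = set zs" using ys(3) unfolding bases_def by blast
  have y0: "X y0 \<noteq> 0"
    using gp_perm[OF gp zs(1) ys(2) zs(2)] ys(4)[of 0] by (simp add: del_nth_def)
  show "X d \<noteq> 0"
  proof (cases "d = y0")
    case False
    obtain B where B: "B \<in> bases \<phi>" "C - {d} \<subseteq> B"
      using circuit_minus_indep[OF C d] .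
    obtain xs where xs: "\<phi> (y0 # xs) \<noteq> 0" "set (y0 # xs) = B"
      using basis_front[OF gp B(1), of y0] B(2) ys(1) False by blast
    have "X d * \<phi> (d # xs) = eps * (X y0 * \<phi> (y0 # xs))"
      using circuit_vector_relation[OF gp C X ys(1) d _ xs(1) _ y0] False xs(2) B(2) by blast
    then show ?thesis using xs(1) y0 eps_props(1) by (metis mult_eq_0)
  qed (use y0 in simp)
qed

lemma circuit_vector_unique:
  assumes gp: "gp_function n r \<phi>" and C: "circuit n \<phi> C"
    and X: "circuit_vector \<phi> C X" and Y: "circuit_vector \<phi> C Y"
  shows "\<exists>a. a \<noteq> 0 \<and> Y = (\<lambda>i. a * X i)"
proof -
  obtain c where c: "c \<in> C" using X unfolding circuit_vector_def by blast
  have Xc: "X c \<noteq> 0" and Yc: "Y c \<noteq> 0" using circuit_vector_nonzero[OF gp C] X Y c by auto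
  obtain u where u: "X c * u = 1" using ex_inverse[OF Xc] by blast
  then have u0: "u \<noteq> 0" by (metis mult_zero_right zero_neq_one)
  have "Y d = Y c * u * X d" for d
  proof (cases "d \<in> C")
    case False
    then show ?thesis using circuit_vector_off[OF gp C X] circuit_vector_off[OF gp C Y] by simp
  next
    case True
    show ?thesis
    proof (cases "d = c")
      case True
      then show ?thesis using u by (simp add: mult.assoc mult.commute[of u])
    next
      case False
      obtain B where B: "B \<in> bases \<phi>" "C - {d} \<subseteq> B"
        using circuit_minus_indep[OF C \<open>d \<in> C\<close>] .
      obtain xs where xs: "\<phi> (c # xs) \<noteq> 0" "set (c # xs) = B"
        using basis_front[OF gp B(1), of c] B(2) c False by blast
      have x: "X d * \<phi> (d # xs) = eps * (X c * \<phi> (c # xs))"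
        using circuit_vector_relation[OF gp C X c \<open>d \<in> C\<close> _ xs(1) _ Xc] False xs(2) B(2) by blast
      have y: "Y d * \<phi> (d # xs) = eps * (Y c * \<phi> (c # xs))"
        using circuit_vector_relation[OF gp C Y c \<open>d \<in> C\<close> _ xs(1) _ Yc] False xs(2) B(2) by blast
      have nz: "\<phi> (d # xs) \<noteq> 0" using x Xc xs(1) eps_props(1) by (metis mult_eq_0)
      have "\<phi> (d # xs) * (Y c * u * X d) = Y c * u * (X d * \<phi> (d # xs))" by (simp add: mult_ac)
      also have "\<dots> = (X c * u) * (eps * (Y c * \<phi> (c # xs)))" unfolding x by (simp add: mult_ac)
      also have "\<dots> = \<phi> (d # xs) * Y d" unfolding u y[symmetric] by (simp add: mult_ac)
      finally show ?thesis using mult_cancel[OF nz] by metis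
    qed
  qed
  then show ?thesis using mult_nonzero[OF Yc u0] by blast
qed

end

theory Submission
  imports Defs
begin

text \<open>
  Expanding a Grassmann--Pluecker function \<open>\<nu>\<close> of \<open>N\<close> along a tuple \<open>ys\<close> gives a multiple of a
  circuit of \<open>N\<close>, and \<open>e \<mapsto> \<tau> (\<mu> (e # xs))\<close> is, for a Grassmann--Pluecker function \<open>\<mu>\<close> of \<open>M\<close>, a
  multiple of a cocircuit of \<open>M\<close>; all circuits and cocircuits arise in this way.  Hence \<open>N\<close> is
  above \<open>M\<close> in the quotient order iff the circuits of \<open>N\<close> are orthogonal to the cocircuits of \<open>M\<close>.
  For \<open>N = M\<close> this shows that cocircuits are covectors, so an inclusion of the covectors of \<open>M\<close> in
  those of \<open>N\<close> forces the quotient relation.  Conversely, the quotient relation makes the circuits of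
  \<open>N\<close> vectors of \<open>M\<close>, and over a perfect tract these are orthogonal to all covectors of \<open>M\<close>.
\<close>

section \<open>The unit \<open>eps\<close>, the nullset and formal sums\<close>

text \<open>The null pair of \<open>1\<close> and \<open>eps\<close> may be read in either order,
  and the second entry is \<open>eps\<close> times the first.\<close>

lemma eps_eps: "eps * eps = (1::'a::tract)"
proof -
  have "{#eps, 1::'a#} \<in> nullset"
    using eps_props(2) by (simp add: add_mset_commute)
  then show ?thesis using pair_in_nullset[OF _ eps_props(1)] by metis
qed

lemma eps_power_cancel [simp]:
  "eps ^ k * eps ^ k = (1::'a::tract)" "eps ^ k * (eps ^ k * x) = (x::'a::tract)"
proof -
  show *: "eps ^ k * eps ^ k = (1::'a)"
    by (metis eps_eps power_mult_distrib power_one)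
  show "eps ^ k * (eps ^ k * x) = x"
    by (metis * mult.assoc mult_1)
qed

lemma eps_cancel [simp]: "eps * (eps * x) = (x::'a::tract)"
  by (metis eps_eps mult.assoc mult_1)

lemma eps_power_nonzero [simp]: "eps ^ k \<noteq> (0::'a::tract)"
  using power_eq_0 eps_props(1) by blast

lemma nullset_scale_iff:
  assumes "(a::'a::tract) \<noteq> 0"
  shows "image_mset ((*) a) A \<in> nullset \<longleftrightarrow> A \<in> nullset"
proof
  obtain b where b: "a * b = 1" using ex_inverse[OF assms] by blast
  then have "b \<noteq> 0" by (metis mult_zero_right zero_neq_one)
  moreover have "b * (a * x) = x" for x
    using b by (metis mult.assoc mult.commute mult_1)
  moreover assume "image_mset ((*) a) A \<in> nullset"
  ultimately show "A \<in> nullset"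
    using nullset_scale[of b "image_mset ((*) a) A"] by (simp add: multiset.map_comp o_def)
qed (rule nullset_scale[OF assms])

lemma fsum_cong: "(\<And>i. i \<in> I \<Longrightarrow> f i = g i) \<Longrightarrow> fsum f I = fsum g I"
  unfolding fsum_def
  by (cases "finite I") (auto intro!: arg_cong[where f = "filter_mset _"] image_mset_cong)

lemma fsum_reindex: "inj_on h I \<Longrightarrow> fsum f (h ` I) = fsum (\<lambda>i. f (h i)) I"
  unfolding fsum_def by (simp add: image_mset_mset_set[symmetric] multiset.map_comp o_def)

lemma fsum_zero: "(\<And>i. i \<in> I \<Longrightarrow> f i = 0) \<Longrightarrow> fsum f I = {#}"
  unfolding fsum_def by (cases "finite I") (auto simp: filter_mset_eq_conv)

lemma fsum_Un_disjoint:
  "finite I \<Longrightarrow> finite J \<Longrightarrow> I \<inter> J = {} \<Longrightarrow> fsum f (I \<union> J) = fsum f I + fsum f J"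
  unfolding fsum_def by (simp add: mset_set_Union)

lemma fsum_mono_neutral:
  assumes "finite I" "J \<subseteq> I" "\<And>i. i \<in> I - J \<Longrightarrow> f i = 0"
  shows "fsum f I = fsum f J"
proof -
  have "fsum f I = fsum f (J \<union> (I - J))"
    using assms(2) by (simp add: Un_absorb1)
  also have "\<dots> = fsum f J + fsum f (I - J)"
    using assms(1,2) by (intro fsum_Un_disjoint) (auto intro: finite_subset)
  also have "fsum f (I - J) = {#}" using assms(3) by (intro fsum_zero)
  finally show ?thesis by simp
qed

lemma fsum_scale_iff:
  assumes "c \<noteq> 0"
  shows "fsum (\<lambda>i. c * f i) I \<in> nullset \<longleftrightarrow> fsum f I \<in> nullset"
proof -
  have "fsum (\<lambda>i. c * f i) I = image_mset ((*) c) (fsum f I)"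
    unfolding fsum_def using assms
    by (simp add: filter_mset_image_mset multiset.map_comp o_def mult_eq_0)
  then show ?thesis using nullset_scale_iff[OF assms] by metis
qed

text \<open>Used to refute independence: a Pluecker sum with exactly one nonzero term violates its
  relation.\<close>

lemma fsum_single_notin_nullset:
  assumes "finite I" "p \<in> I" "f p \<noteq> 0" "\<And>i. i \<in> I \<Longrightarrow> i \<noteq> p \<Longrightarrow> f i = 0"
  shows "fsum f I \<notin> nullset"
proof -
  have "fsum f I = fsum f {p}" using assms by (intro fsum_mono_neutral) auto
  also have "\<dots> = {#f p#}" using assms(3) by (simp add: fsum_def)
  finally show ?thesis using singleton_notin_nullset[OF assms(3)] by metis
qed

lemma fsum_pair_in_nullset:
  assumes "finite I" "p \<in> I" "q \<in> I" "p \<noteq> q" "f q = eps * f p"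
    "\<And>i. i \<in> I \<Longrightarrow> i \<noteq> p \<Longrightarrow> i \<noteq> q \<Longrightarrow> f i = 0"
  shows "fsum f I \<in> nullset"
proof (cases "f p = 0")
  case True
  then have "fsum f I = {#}" using assms by (intro fsum_zero) (metis mult_zero_right)
  then show ?thesis by (simp add: empty_in_nullset)
next
  case False
  have "fsum f I = fsum f {p, q}" using assms by (intro fsum_mono_neutral) auto
  also have "\<dots> = image_mset ((*) (f p)) {#1, eps#}"
    using False assms(4,5) eps_props(1) by (simp add: fsum_def mult_eq_0 mult.commute)
  finally show ?thesis using nullset_scale[OF False eps_props(2)] by metis
qed

section \<open>Involutions and orthogonality\<close>

context
  fixes \<tau> :: "'a::tract \<Rightarrow> 'a"
  assumes inv: "tract_involution \<tau>"
begin

lemma involution_simps: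
  "\<tau> (\<tau> x) = x" "\<tau> 0 = 0" "\<tau> 1 = 1" "\<tau> (x * y) = \<tau> x * \<tau> y" "\<tau> x = 0 \<longleftrightarrow> x = 0"
proof -
  show *: "\<tau> (\<tau> x) = x" "\<tau> 0 = 0" "\<tau> 1 = 1" "\<tau> (x * y) = \<tau> x * \<tau> y" for x y
    using inv unfolding tract_involution_def tract_morphism_def by auto
  show "\<tau> x = 0 \<longleftrightarrow> x = 0" by (metis *(1,2))
qed

lemma involution_nullset: "A \<in> nullset \<Longrightarrow> image_mset \<tau> A \<in> nullset"
  using inv unfolding tract_involution_def tract_morphism_def by auto

lemma involution_eps: "\<tau> eps = eps"
  using involution_nullset[OF eps_props(2)] eps_props(1)
  by (intro eps_unique) (simp_all add: involution_simps)

lemma involution_eps_power: "\<tau> (eps ^ k) = eps ^ k"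
  by (induction k) (simp_all add: involution_simps involution_eps)

lemma involution_fsum:
  assumes "fsum f I \<in> nullset"
  shows "fsum (\<lambda>i. \<tau> (f i)) I \<in> nullset"
proof -
  have "fsum (\<lambda>i. \<tau> (f i)) I = image_mset \<tau> (fsum f I)"
    unfolding fsum_def
    by (simp add: filter_mset_image_mset multiset.map_comp o_def involution_simps)
  then show ?thesis using involution_nullset[OF assms] by metis
qed

text \<open>Applying \<open>\<tau>\<close> turns each term \<open>X i * \<tau> (Y i)\<close> into
  \<open>Y i * \<tau> (X i)\<close> and preserves the nullset.\<close>

lemma orth_commute: "orth \<tau> n X Y \<longleftrightarrow> orth \<tau> n Y X"
proof -
  have "orth \<tau> n Y X" if "orth \<tau> n X Y" for X Y
    using involution_fsum[OF that[unfolded orth_def]] unfolding orth_def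
    by (simp add: mult.commute involution_simps)
  then show ?thesis by blast
qed

lemma orth_scale_left: "a \<noteq> 0 \<Longrightarrow> orth \<tau> n (\<lambda>i. a * X i) Y \<longleftrightarrow> orth \<tau> n X Y"
  unfolding orth_def by (simp add: mult.assoc fsum_scale_iff)

lemma orth_scale_right: "a \<noteq> 0 \<Longrightarrow> orth \<tau> n X (\<lambda>i. a * Y i) \<longleftrightarrow> orth \<tau> n X Y"
  using orth_commute orth_scale_left by metis

end

section \<open>Alternating functions\<close>

text \<open>Adjacent swaps in lists of any length: this form survives fixing a prefix, which the
  inductions need, and it covers both Grassmann-Pluecker functions and signs.\<close>

definition alternating :: "('b list \<Rightarrow> 'a::tract) \<Rightarrow> bool" where
  "alternating f \<longleftrightarrow> (\<forall>us a b vs. f (us @ b # a # vs) = eps * f (us @ a # b # vs))"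

lemma alternating_append: "alternating f \<Longrightarrow> alternating (\<lambda>xs. f (us @ xs))"
  unfolding alternating_def by (metis append_assoc)

lemma alternating_move_front:
  "alternating f \<Longrightarrow> f (us @ a # vs) = eps ^ length us * f (a # us @ vs)"
proof (induction us arbitrary: f)
  case (Cons u us)
  have "f ((u # us) @ a # vs) = eps ^ length us * f ([u] @ a # us @ vs)"
    using Cons.IH[OF alternating_append[OF Cons.prems, of "[u]"]] by simp
  also have "f ([u] @ a # us @ vs) = eps * f (a # u # us @ vs)"
    using Cons.prems[unfolded alternating_def, rule_format, of "[]" a u] by simp
  finally show ?case by (simp add: mult_ac)
qed simp

text \<open>The sign \<open>eps ^ k\<close> relating two arrangements does not depend on the alternating function.\<close>

lemma alternating_permute:
  fixes xs ys :: "'b list"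
  assumes "mset xs = mset ys"
  shows "\<exists>k. \<forall>f :: 'b list \<Rightarrow> 'a::tract. alternating f \<longrightarrow> f xs = eps ^ k * f ys"
  using assms
proof (induction xs arbitrary: ys)
  case Nil
  then show ?case by (auto intro!: exI[of _ 0])
next
  case (Cons a xs)
  have "a \<in> set ys" using Cons.prems by (metis list.set_intros(1) set_mset_mset)
  then obtain us vs where ys: "ys = us @ a # vs" by (metis split_list)
  then have "mset xs = mset (us @ vs)" using Cons.prems by simp
  then obtain k where k: "\<And>f :: 'b list \<Rightarrow> 'a. alternating f \<Longrightarrow> f xs = eps ^ k * f (us @ vs)"
    using Cons.IH by blast
  have "f (a # xs) = eps ^ (k + length us) * f ys" if f: "alternating f"
    for f :: "'b list \<Rightarrow> 'a"
    using k[OF alternating_append[OF f, of "[a]"]] alternating_move_front[OF f, of us a vs]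
    by (simp add: ys power_add mult.assoc)
  then show ?case by blast
qed

lemma gp_alternating:
  assumes "gp_function n r \<phi>"
  shows "alternating \<phi>"
  unfolding alternating_def
proof (intro allI)
  fix us a b vs
  show "\<phi> (us @ b # a # vs) = eps * \<phi> (us @ a # b # vs)"
  proof (cases "us @ a # b # vs \<in> tuples n r")
    case True
    then show ?thesis
      using gp_swap[OF assms True, of "length us" "Suc (length us)"]
      by (simp add: tuples_def nth_append list_update_append)
  next
    case False
    then have "us @ b # a # vs \<notin> tuples n r" by (auto simp: tuples_def)
    then show ?thesis using False assms unfolding gp_function_def by simp
  qed
qed

section \<open>Change of representative\<close>

lemma plucker_sum_scale:
  assumes "a \<noteq> 0" "b \<noteq> 0"
  shows "plucker_sum (\<lambda>zs. a * \<nu> zs) (\<lambda>zs. b * \<mu> zs) ys xs \<in> nullset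
    \<longleftrightarrow> plucker_sum \<nu> \<mu> ys xs \<in> nullset"
proof -
  have "plucker_sum (\<lambda>zs. a * \<nu> zs) (\<lambda>zs. b * \<mu> zs) ys xs =
    fsum (\<lambda>k. (a * b) * (eps ^ k * \<nu> (del_nth (k - 1) ys) * \<mu> (ys ! (k - 1) # xs))) {1..length ys}"
    unfolding plucker_sum_def by (intro fsum_cong) (simp add: mult_ac)
  then show ?thesis
    by (simp only: fsum_scale_iff[OF mult_nonzero[OF assms]] plucker_sum_def)
qed

lemma gp_function_scale:
  assumes "gp_function n r \<phi>" "a \<noteq> 0"
  shows "gp_function n r (\<lambda>xs. a * \<phi> xs)"
  using assms unfolding gp_function_def plucker_sum_scale[OF assms(2,2)]
  by (simp add: mult_eq_0 mult.left_commute)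

lemma F_matroid_gp:
  assumes "F_matroid n M" "\<phi> \<in> M"
  shows "gp_function n (mrank M) \<phi>"
proof -
  obtain r \<phi>0 where 0: "gp_function n r \<phi>0" "M = gp_class \<phi>0"
    using assms(1) unfolding F_matroid_def by blast
  then obtain a where "a \<noteq> 0" "\<phi> = (\<lambda>xs. a * \<phi>0 xs)"
    using assms(2) unfolding gp_class_def by blast
  then show ?thesis using gp_function_scale[OF 0(1)] mrank_gp_class[OF 0(1)] 0(2) by simp
qed

lemma F_matroid_scale:
  assumes "F_matroid n M" "\<phi> \<in> M" "a \<noteq> 0"
  shows "(\<lambda>xs. a * \<phi> xs) \<in> M"
proof -
  obtain \<phi>0 where 0: "M = gp_class \<phi>0"
    using assms(1) unfolding F_matroid_def by blast
  then obtain b where "b \<noteq> 0" "\<phi> = (\<lambda>xs. b * \<phi>0 xs)"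
    using assms(2) unfolding gp_class_def by blast
  then have "a * b \<noteq> 0" "(\<lambda>xs. a * \<phi> xs) = (\<lambda>xs. (a * b) * \<phi>0 xs)"
    using mult_nonzero[OF assms(3)] by (simp_all add: mult.assoc)
  then show ?thesis unfolding 0 gp_class_def by blast
qed

section \<open>Deletions from tuples and repeated entries\<close>

lemma nth_del_nth:
  "k < length ys \<Longrightarrow> m < length ys - 1 \<Longrightarrow>
    del_nth k ys ! m = ys ! (if m < k then m else Suc m)"
  by (auto simp: del_nth_def nth_append min_def)

lemma length_del_nth: "k < length ys \<Longrightarrow> length (del_nth k ys) = length ys - 1"
  by (auto simp: del_nth_def)

lemma del_nth_append [simp]: "del_nth (length us) (us @ a # vs) = us @ vs"
  by (simp add: del_nth_def)

lemma not_distinct_del_nth: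
  assumes "k < length ys" "i < j" "j < length ys" "ys ! i = ys ! j" "k \<noteq> i" "k \<noteq> j"
  shows "\<not> distinct (del_nth k ys)"
proof
  assume d: "distinct (del_nth k ys)"
  let ?s = "\<lambda>i. if i < k then i else i - 1"
  have "del_nth k ys ! ?s i = del_nth k ys ! ?s j"
    using assms by (auto simp: nth_del_nth)
  moreover have "?s i < length (del_nth k ys)" "?s j < length (del_nth k ys)"
    using assms by (auto simp: length_del_nth)
  ultimately have "?s i = ?s j" using d by (simp add: nth_eq_iff_index_eq)
  then show False using assms by (auto split: if_splits)
qed

text \<open>For repeated entries only two terms survive, and they differ by the factor \<open>eps\<close>.\<close>

lemma plucker_sum_not_distinct:
  assumes "gp_function n w \<nu>" "\<not> distinct ys"
  shows "plucker_sum \<nu> \<mu> ys xs \<in> nullset"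
proof -
  obtain p y q s where ys: "ys = p @ y # q @ y # s"
    using not_distinct_decomp[OF assms(2)] by auto
  let ?i = "length p" and ?j = "length p + Suc (length q)"
  let ?f = "\<lambda>k. eps ^ k * \<nu> (del_nth (k - 1) ys) * \<mu> (ys ! (k - 1) # xs)"
  have nth: "ys ! ?i = y" "ys ! ?j = y" unfolding ys by (simp_all add: nth_append)
  have di: "del_nth ?i ys = p @ q @ y # s" unfolding ys by simp
  have dj: "del_nth ?j ys = p @ y # q @ s"
    using del_nth_append[of "p @ y # q" y s] unfolding ys by simp
  have sw: "\<nu> (p @ q @ y # s) = eps ^ length q * \<nu> (p @ y # q @ s)"
    using alternating_move_front[OF alternating_append[OF gp_alternating[OF assms(1)]], of p q y s] .
  have z: "?f k = 0" if "k \<in> {1..length ys}" "k \<noteq> Suc ?i" "k \<noteq> Suc ?j" for k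
  proof -
    have "\<not> distinct (del_nth (k - 1) ys)"
      using that nth by (intro not_distinct_del_nth[where i = ?i and j = ?j]) (auto simp: ys)
    then have "\<nu> (del_nth (k - 1) ys) = 0" using gp_support(3)[OF assms(1)] by blast
    then show ?thesis by simp
  qed
  \<comment> \<open>The gap between the two positions gives \<open>eps ^ Suc (length q)\<close>, and
    moving \<open>y\<close> past \<open>q\<close> costs \<open>eps ^ length q\<close>; one factor
    \<open>eps\<close> remains.\<close>
  have "?f (Suc ?j) = eps * ?f (Suc ?i)"
    using di dj nth sw by (simp add: power_add mult_ac)
  then show ?thesis unfolding plucker_sum_def
    using z by (intro fsum_pair_in_nullset[where p = "Suc ?i" and q = "Suc ?j"]) (auto simp: ys)
qed

section \<open>Elimination vectors and circuits\<close>

text \<open>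
  The vectors of \<open>circuit_vector\<close>, without the requirement that \<open>ys\<close> starts with an element of the
  circuit; for \<open>ys\<close> with repeated entries the condition may be unsatisfiable.
\<close>

definition elim_vector :: "(nat list \<Rightarrow> 'a::tract) \<Rightarrow> nat list \<Rightarrow> (nat \<Rightarrow> 'a) \<Rightarrow> bool" where
  "elim_vector \<nu> ys X \<longleftrightarrow>
     (\<forall>i<length ys. X (ys ! i) = eps ^ i * \<nu> (del_nth i ys)) \<and> (\<forall>y. y \<notin> set ys \<longrightarrow> X y = 0)"

lemma elim_vector_nth:
  "elim_vector \<nu> ys X \<Longrightarrow> i < length ys \<Longrightarrow> X (ys ! i) = eps ^ i * \<nu> (del_nth i ys)"
  unfolding elim_vector_def by blast

lemma elim_vector_split:
  assumes "elim_vector \<nu> (us @ e # vs) X"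
  shows "X e = eps ^ length us * \<nu> (us @ vs)"
  using elim_vector_nth[OF assms, of "length us"] by simp

lemma elim_vector_off: "elim_vector \<nu> ys X \<Longrightarrow> y \<notin> set ys \<Longrightarrow> X y = 0"
  unfolding elim_vector_def by blast

lemma elim_vectorI:
  assumes "\<And>us e vs. ys = us @ e # vs \<Longrightarrow> X e = eps ^ length us * \<nu> (us @ vs)"
    and "\<And>y. y \<notin> set ys \<Longrightarrow> X y = 0"
  shows "elim_vector \<nu> ys X"
  unfolding elim_vector_def
proof (intro conjI allI impI)
  fix i assume i: "i < length ys"
  then show "X (ys ! i) = eps ^ i * \<nu> (del_nth i ys)"
    using assms(1)[OF id_take_nth_drop[OF i]] by (simp add: del_nth_def min_def)
qed (use assms(2) in blast)

text \<open>Without repetitions each entry has one position, so the prescribed values cannot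
  conflict.\<close>

lemma ex_elim_vector:
  assumes "distinct ys"
  shows "\<exists>X. elim_vector \<nu> ys X"
proof -
  define ix where "ix y = (THE i. i < length ys \<and> ys ! i = y)" for y
  have "ix (ys ! i) = i" if "i < length ys" for i
    unfolding ix_def using that assms by (intro the_equality) (auto simp: nth_eq_iff_index_eq)
  then have "elim_vector \<nu> ys
      (\<lambda>y. if y \<in> set ys then eps ^ ix y * \<nu> (del_nth (ix y) ys) else 0)"
    unfolding elim_vector_def by simp
  then show ?thesis by blast
qed

text \<open>Every coordinate changes by the same sign. For \<open>e\<close> in \<open>us\<close> the
  position drops by one and \<open>y0\<close> passes the other entries of \<open>us\<close>; for
  \<open>e\<close> in \<open>vs\<close> the position stays and \<open>y0\<close> passes all of
  \<open>us\<close>; for \<open>e = y0\<close> only the position changes.\<close>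

lemma elim_vector_move:
  assumes alt: "alternating \<nu>" and X: "elim_vector \<nu> (y0 # us @ vs) X"
    and d: "distinct (y0 # us @ vs)"
  shows "elim_vector \<nu> (us @ y0 # vs) (\<lambda>e. eps ^ length us * X e)"
proof (rule elim_vectorI)
  fix us' e vs' assume eq: "us @ y0 # vs = us' @ e # vs'"
  then have "e \<in> set (us @ y0 # vs)" by simp
  then consider "e = y0" | "e \<in> set us" | "e \<in> set vs" by auto
  then show "eps ^ length us * X e = eps ^ length us' * \<nu> (us' @ vs')"
  proof cases
    case 1
    then have "us' = us" "vs' = vs" using eq d append_Cons_eq_iff[of y0 us vs us' vs'] by auto
    then show ?thesis using elim_vector_split[of \<nu> "[]" y0 "us @ vs" X] X 1 by simp
  next
    case 2
    then obtain p q where us: "us = p @ e # q" by (metis split_list)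
    then have v: "us' = p" "vs' = q @ y0 # vs"
      using eq d append_Cons_eq_iff[of e p "q @ y0 # vs" us' vs'] by auto
    have "\<nu> ((p @ q) @ y0 # vs) = eps ^ length (p @ q) * \<nu> (y0 # (p @ q) @ vs)"
      by (rule alternating_move_front[OF alt])
    then show ?thesis
      using elim_vector_split[of \<nu> "y0 # p" e "q @ vs" X] X
      by (simp add: us v power_add mult_ac)
  next
    case 3
    then obtain p q where vs: "vs = p @ e # q" by (metis split_list)
    then have v: "us' = us @ y0 # p" "vs' = q"
      using eq d append_Cons_eq_iff[of e "us @ y0 # p" q us' vs'] by auto
    have "\<nu> (us @ y0 # p @ q) = eps ^ length us * \<nu> (y0 # us @ p @ q)"
      by (rule alternating_move_front[OF alt])
    then show ?thesis
      using elim_vector_split[of \<nu> "y0 # us @ p" e q X] X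
      by (simp add: vs v power_add mult_ac)
  qed
next
  fix y assume "y \<notin> set (us @ y0 # vs)"
  then have "X y = 0" using elim_vector_off[OF X, of y] by simp
  then show "eps ^ length us * X y = 0" by simp
qed

lemma bij_betw_nth_pred:
  assumes "distinct ys"
  shows "bij_betw (\<lambda>k. ys ! (k - 1)) {1..length ys} (set ys)"
  unfolding bij_betw_def
proof
  let ?h = "\<lambda>k. ys ! (k - 1)"
  show "inj_on ?h {1..length ys}"
    using assms by (auto simp: inj_on_def nth_eq_iff_index_eq)
  have "?h ` {1..length ys} = (\<lambda>i. ?h (Suc i)) ` {..<length ys}"
    by (simp only: image_Suc_lessThan[symmetric] image_image)
  also have "\<dots> = set ys" by (simp add: set_conv_nth image_def Bex_def conj_commute)
  finally show "?h ` {1..length ys} = set ys" .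
qed

text \<open>Since \<open>X\<close> vanishes off \<open>ys\<close>, the orthogonality sum runs over
  the entries of \<open>ys\<close>; reindexed by positions, it is the Pluecker sum up to a factor
  \<open>eps\<close>. The two involutions cancel.\<close>

lemma plucker_sum_iff_orth:
  assumes inv: "tract_involution \<tau>" and X: "elim_vector \<nu> ys X"
    and ys: "distinct ys" "set ys \<subseteq> {1..n}"
  shows "plucker_sum \<nu> \<mu> ys xs \<in> nullset \<longleftrightarrow> orth \<tau> n X (\<lambda>e. \<tau> (\<mu> (e # xs)))"
proof -
  let ?h = "\<lambda>k. ys ! (k - 1)" and ?g = "\<lambda>e. X e * \<mu> (e # xs)"
  have h: "?h ` {1..length ys} = set ys" and inj: "inj_on ?h {1..length ys}"
    using bij_betw_nth_pred[OF ys(1)] unfolding bij_betw_def by auto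
  have "fsum (\<lambda>e. X e * \<tau> (\<tau> (\<mu> (e # xs)))) {1..n} = fsum ?g (set ys)"
    unfolding involution_simps(1)[OF inv]
    using ys(2) elim_vector_off[OF X] by (intro fsum_mono_neutral) auto
  also have "\<dots> = fsum (\<lambda>k. ?g (?h k)) {1..length ys}"
    using fsum_reindex[OF inj, of ?g] h by simp
  finally have 1: "orth \<tau> n X (\<lambda>e. \<tau> (\<mu> (e # xs))) \<longleftrightarrow>
      fsum (\<lambda>k. ?g (?h k)) {1..length ys} \<in> nullset"
    unfolding orth_def by simp
  \<comment> \<open>The extra \<open>eps\<close> appears because positions count from
    \<open>1\<close> in \<open>plucker_sum\<close> and from \<open>0\<close> in
    \<open>elim_vector\<close>.\<close>
  have "plucker_sum \<nu> \<mu> ys xs = fsum (\<lambda>k. eps * ?g (?h k)) {1..length ys}"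
    unfolding plucker_sum_def
  proof (rule fsum_cong)
    fix k assume "k \<in> {1..length ys}"
    then obtain i where "k = Suc i" "i < length ys" by (cases k) auto
    then show "eps ^ k * \<nu> (del_nth (k - 1) ys) * \<mu> (ys ! (k - 1) # xs) = eps * ?g (?h k)"
      using elim_vector_nth[OF X] by (simp add: mult_ac)
  qed
  then show ?thesis by (simp only: 1 fsum_scale_iff[OF eps_props(1)])
qed

lemma circuit_vectorE:
  assumes C: "circuit n \<phi> C" and X: "circuit_vector \<phi> C X"
  obtains y0 ys where "distinct (y0 # ys)" "y0 \<in> {1..n}" "set ys \<in> bases \<phi>"
    "elim_vector \<phi> (y0 # ys) X"
proof -
  obtain y0 ys where ys: "y0 \<in> C" "distinct ys" "set ys \<in> bases \<phi>" "C - {y0} \<subseteq> set ys"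
    "\<And>i. i \<le> length ys \<Longrightarrow> X ((y0 # ys) ! i) = eps ^ i * \<phi> (del_nth i (y0 # ys))"
    "\<And>y. y \<notin> set (y0 # ys) \<Longrightarrow> X y = 0"
    using X unfolding circuit_vector_def by blast
  \<comment> \<open>Otherwise the circuit \<open>C\<close> would lie in the basis
    \<open>set ys\<close>.\<close>
  have "y0 \<notin> set ys"
    using C ys(1,3,4) unfolding circuit_def indep_def by blast
  then have "distinct (y0 # ys)" using ys(2) by simp
  moreover have "y0 \<in> {1..n}" using C ys(1) unfolding circuit_def by blast
  moreover have "elim_vector \<phi> (y0 # ys) X"
    unfolding elim_vector_def using ys(5,6) by (metis length_Cons less_Suc_eq_le)
  ultimately show thesis using that ys(3) by blast
qed

lemma circuit_vectorI:
  assumes "elim_vector \<phi> (y0 # ys) X" "distinct ys" "set ys \<in> bases \<phi>" "X y0 \<noteq> 0"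
  shows "circuit_vector \<phi> {e. X e \<noteq> 0} X"
proof -
  have "{e. X e \<noteq> 0} - {y0} \<subseteq> set ys"
    using elim_vector_off[OF assms(1)] by auto
  moreover have "\<forall>i\<le>length ys. X ((y0 # ys) ! i) = eps ^ i * \<phi> (del_nth i (y0 # ys))"
    using elim_vector_nth[OF assms(1)] by simp
  moreover have "\<forall>y. y \<notin> set (y0 # ys) \<longrightarrow> X y = 0"
    using elim_vector_off[OF assms(1)] by blast
  ultimately show ?thesis
    unfolding circuit_vector_def using assms(2-4) by (intro exI[of _ y0] exI[of _ ys]) simp
qed

text \<open>The support of \<open>X\<close> is the fundamental circuit of \<open>y0\<close> with
  respect to the basis \<open>ys\<close>. A Pluecker relation shows that it is dependent; minimality
  comes from exchanging elements of the support for \<open>y0\<close>.\<close>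

lemma elim_vector_circuit:
  fixes \<phi> :: "nat list \<Rightarrow> 'a::tract"
  assumes gp: "gp_function n r \<phi>" and X: "elim_vector \<phi> (y0 # ys) X"
    and d: "distinct (y0 # ys)" and y0: "y0 \<in> {1..n}" and nz: "\<phi> ys \<noteq> 0"
  shows "circuit n \<phi> {e. X e \<noteq> 0}" "circuit_vector \<phi> {e. X e \<noteq> 0} X"
proof -
  let ?l = "y0 # ys" and ?C = "{e. X e \<noteq> 0}"
  have Xy0: "X y0 \<noteq> 0" using elim_vector_split[of \<phi> "[]" y0 ys X] X nz by simp
  have Cl: "?C \<subseteq> set ?l" using elim_vector_off[OF X] by auto
  have l: "set ?l \<subseteq> {1..n}" "length ys = r" using gp_support[OF gp nz] y0 by auto
  show "circuit_vector \<phi> ?C X"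
    using circuit_vectorI[OF X] d nz Xy0 unfolding bases_def by auto
  have "\<not> indep \<phi> ?C"
  proof
    assume "indep \<phi> ?C"
    then obtain B where B: "B \<in> bases \<phi>" "?C \<subseteq> B" unfolding indep_def by blast
    obtain xs where xs: "\<phi> (y0 # xs) \<noteq> 0" "set (y0 # xs) = B"
      using basis_front[OF gp B(1), of y0] B(2) Xy0 by blast
    have sx: "Suc (length xs) = r" "set xs \<subseteq> {1..n}" using gp_support[OF gp xs(1)] by auto
    let ?f = "\<lambda>k. eps ^ k * \<phi> (del_nth (k - 1) ?l) * \<phi> (?l ! (k - 1) # xs)"
    \<comment> \<open>Off the support of \<open>X\<close> the first factor vanishes; an entry of the
      support other than \<open>y0\<close> lies in \<open>xs\<close> and kills the second. Only the
      term deleting \<open>y0\<close> remains.\<close>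
    have "?f k = 0" if k: "k \<in> {1..length ?l}" "k \<noteq> 1" for k
    proof -
      let ?y = "?l ! (k - 1)"
      have k1: "k - 1 < length ?l" "k - 1 \<noteq> 0" using k by auto
      show ?thesis
      proof (cases "X ?y = 0")
        case True
        then show ?thesis using elim_vector_nth[OF X k1(1)] by (simp add: mult_eq_0)
      next
        case False
        have "?y \<noteq> y0" using d k1 nth_eq_iff_index_eq[OF d, of "k - 1" 0] by simp
        then have "?y \<in> set xs" using False B(2) xs(2) by auto
        then have "\<phi> (?y # xs) = 0" using gp_support(3)[OF gp, of "?y # xs"] by auto
        then show ?thesis by simp
      qed
    qed
    moreover have "?f 1 \<noteq> 0" using nz xs(1) eps_props(1) by (simp add: del_nth_def mult_eq_0)
    ultimately have "fsum ?f {1..length ?l} \<notin> nullset"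
      by (intro fsum_single_notin_nullset[where p = 1]) auto
    moreover have "?l \<in> tuples n (Suc r)" using l by (simp add: tuples_def)
    ultimately show False
      using gp_relation[OF gp _ sx] unfolding plucker_sum_def by blast
  qed
  moreover have "indep \<phi> D" if D: "D \<subset> ?C" for D
  proof -
    obtain e where e: "X e \<noteq> 0" "e \<notin> D" using D by blast
    then have "e \<in> set ?l" using Cl by blast
    then obtain us vs where uv: "?l = us @ e # vs" by (metis split_list)
    \<comment> \<open>A nonzero coordinate at \<open>e\<close> means that deleting \<open>e\<close>
      from \<open>y0 # ys\<close> leaves a basis.\<close>
    then have "\<phi> (us @ vs) \<noteq> 0" using elim_vector_split[of \<phi> us e vs X] X e(1) by auto
    moreover have "D \<subseteq> set (us @ vs)"
    proof -
      have "D \<subseteq> set (us @ e # vs)" using D Cl unfolding uv by blast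
      then show ?thesis using e(2) by auto
    qed
    ultimately show ?thesis unfolding indep_def bases_def by blast
  qed
  ultimately show "circuit n \<phi> ?C" using Cl l(1) unfolding circuit_def by blast
qed

section \<open>Signs of enumerations\<close>

text \<open>On lists that do not enumerate \<open>{1..n}\<close> the value of \<open>tuple_sign\<close> is junk.\<close>

definition esign :: "nat \<Rightarrow> nat list \<Rightarrow> 'a::tract" where
  "esign n zs = (if distinct zs \<and> set zs = {1..n} then tuple_sign zs else 0)"

lemma esign_nonzero: "distinct zs \<Longrightarrow> set zs = {1..n} \<Longrightarrow> esign n zs \<noteq> (0::'a::tract)"
  by (simp add: esign_def tuple_sign_def eps_props(1))

lemma tuple_sign_swap:
  assumes d: "distinct (us @ a # b # vs)" and S: "set (us @ a # b # vs) = {1..n}"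
  shows "tuple_sign (us @ b # a # vs) = (eps::'a::tract) * tuple_sign (us @ a # b # vs)"
proof -
  let ?zs = "us @ a # b # vs" and ?i = "Suc (length us)"
  define p where "p zs i = (if i \<in> {1..length zs} then zs ! (i - 1) else i)" for zs :: "nat list" and i
  have len: "length ?zs = n" using distinct_card[OF d] S by simp
  have "bij_betw (p ?zs) {1..n} {1..n}"
    using bij_betw_nth_pred[OF d] unfolding S len
    by (rule bij_betw_cong[THEN iffD1, rotated]) (simp only: p_def len if_True)
  then have "p ?zs permutes {1..n}"
    by (rule bij_imp_permutes) (simp only: p_def len if_False)
  then have perm: "permutation (p ?zs)" by (metis finite_atLeastAtMost permutation_permutes)
  \<comment> \<open>Swapping adjacent entries precomposes the permutation with the transposition of
    their positions, counted from \<open>1\<close>.\<close>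
  have "p (us @ b # a # vs) = p ?zs \<circ> transpose ?i (Suc ?i)"
  proof
    fix i
    show "p (us @ b # a # vs) i = (p ?zs \<circ> transpose ?i (Suc ?i)) i"
      by (cases "i = ?i \<or> i = Suc ?i")
        (auto simp: p_def transpose_def nth_append nth_Cons' Suc_diff_Suc)
  qed
  then have sgn: "sign (p (us @ b # a # vs)) = - sign (p ?zs)"
    using perm by (simp add: sign_compose permutation_swap_id sign_swap_id)
  have "tuple_sign zs = (if sign (p zs) = 1 then 1 else eps::'a)" for zs
    unfolding tuple_sign_def p_def by simp
  then show ?thesis
    using sgn eps_eps sign_cases[of "p ?zs"] by auto
qed

text \<open>Enumerating \<open>{1..n}\<close> is invariant under swaps, so the value
  \<open>0\<close> on all other lists makes the sign rule total and the rearrangement lemmas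
  applicable.\<close>

lemma esign_alternating: "alternating (esign n :: nat list \<Rightarrow> 'a::tract)"
  unfolding alternating_def
proof (intro allI)
  fix us vs :: "nat list" and a b
  have perm: "distinct (us @ b # a # vs) \<longleftrightarrow> distinct (us @ a # b # vs)"
    "set (us @ b # a # vs) = set (us @ a # b # vs)" by auto
  show "esign n (us @ b # a # vs) = eps * (esign n (us @ a # b # vs) :: 'a)"
  proof (cases "distinct (us @ a # b # vs) \<and> set (us @ a # b # vs) = {1..n}")
    case True
    then show ?thesis
      unfolding esign_def perm by (simp only: simp_thms if_True tuple_sign_swap[of us a b vs n])
  next
    case False
    then show ?thesis
      unfolding esign_def perm by (simp only: if_False mult_zero_right)
  qed
qed

section \<open>Duals and cocircuits\<close>

context
  fixes \<tau> :: "'a::tract \<Rightarrow> 'a"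
  assumes inv: "tract_involution \<tau>"
  notes [simp] = involution_simps[OF inv] involution_eps_power[OF inv]
begin

text \<open>Reordering the sorted complement into \<open>zs\<close> produces the same
  \<open>eps ^ k\<close> in the sign and in \<open>\<mu>\<close>; this power is fixed by
  \<open>\<tau>\<close> and squares to \<open>1\<close>.\<close>

lemma dual_gp_eq:
  fixes \<mu> :: "nat list \<Rightarrow> 'a"
  assumes alt: "alternating \<mu>" and d: "distinct (xs @ zs)" and S: "set (xs @ zs) = {1..n}"
  shows "dual_gp \<tau> n \<mu> xs = esign n (xs @ zs) * \<tau> (\<mu> zs)"
proof -
  let ?s = "sorted_list_of_set ({1..n} - set xs)"
  have zs: "set zs = {1..n} - set xs" and xs: "distinct xs" "set xs \<subseteq> {1..n}" using d S by auto
  then have "mset ?s = mset zs"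
    using d set_eq_iff_mset_eq_distinct[of ?s zs] by simp
  then obtain k where k: "\<And>f :: nat list \<Rightarrow> 'a. alternating f \<Longrightarrow> f ?s = eps ^ k * f zs"
    using alternating_permute by blast
  have "dual_gp \<tau> n \<mu> xs = esign n (xs @ ?s) * \<tau> (\<mu> ?s)"
  proof -
    have "distinct (xs @ ?s)" "set (xs @ ?s) = {1..n}" using xs by auto
    then show ?thesis using xs by (simp add: dual_gp_def Let_def esign_def)
  qed
  also have "\<dots> = esign n (xs @ zs) * \<tau> (\<mu> zs)"
    using k[OF alt] k[OF alternating_append[OF esign_alternating, of n xs]]
    by (simp add: mult_ac)
  finally show ?thesis .
qed

text \<open>Deleting \<open>e\<close> from \<open>l\<close> adds it to the complement
  \<open>xs\<close>. The deletion sign and the moves of \<open>e\<close> within the enumeration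
  together give \<open>eps ^ (length l - 1)\<close>, independently of \<open>e\<close>.\<close>

lemma dual_elim_vector:
  assumes gp: "gp_function n r \<mu>" and d: "distinct (l @ xs)" and S: "set (l @ xs) = {1..n}"
    and X: "elim_vector (dual_gp \<tau> n \<mu>) l X"
  shows "X = (\<lambda>e. eps ^ (length l - 1) * esign n (l @ xs) * \<tau> (\<mu> (e # xs)))"
proof
  fix e
  show "X e = eps ^ (length l - 1) * esign n (l @ xs) * \<tau> (\<mu> (e # xs))"
  proof (cases "e \<in> set l")
    case True
    then obtain us vs where l: "l = us @ e # vs" by (metis split_list)
    have "X e = eps ^ length us * dual_gp \<tau> n \<mu> (us @ vs)"
      using elim_vector_split[of _ us e vs X] X l by blast
    also have "dual_gp \<tau> n \<mu> (us @ vs) = esign n ((us @ vs) @ e # xs) * \<tau> (\<mu> (e # xs))"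
      using d S unfolding l by (intro dual_gp_eq[OF gp_alternating[OF gp]]) auto
    also have "esign n ((us @ vs) @ e # xs) = eps ^ length (us @ vs) * (esign n (e # (us @ vs) @ xs) :: 'a)"
      by (rule alternating_move_front[OF esign_alternating])
    also have "(esign n (e # (us @ vs) @ xs) :: 'a) = eps ^ length us * esign n (l @ xs)"
    proof -
      have "(esign n (us @ e # vs @ xs) :: 'a) = eps ^ length us * esign n (e # us @ vs @ xs)"
        by (rule alternating_move_front[OF esign_alternating])
      then show ?thesis by (simp add: l)
    qed
    finally show ?thesis by (simp add: l power_add mult_ac)
  next
    case False
    \<comment> \<open>Here both sides vanish: \<open>e # xs\<close> has a repetition or leaves
      \<open>{1..n}\<close>.\<close>
    then have "e \<in> set xs \<or> e \<notin> {1..n}" using S by (metis Un_iff set_append)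
    then have "\<mu> (e # xs) = 0" using gp_support(2,3)[OF gp, of "e # xs"] by auto
    then show ?thesis using elim_vector_off[OF X False] by simp
  qed
qed

lemma bases_dual_gp:
  assumes gp: "gp_function n r \<mu>"
  shows "B \<in> bases (dual_gp \<tau> n \<mu>) \<longleftrightarrow> B \<subseteq> {1..n} \<and> {1..n} - B \<in> bases \<mu>"
proof
  assume "B \<in> bases (dual_gp \<tau> n \<mu>)"
  then obtain xs where xs: "dual_gp \<tau> n \<mu> xs \<noteq> 0" "B = set xs" unfolding bases_def by blast
  then have "set xs \<subseteq> {1..n}" "\<mu> (sorted_list_of_set ({1..n} - set xs)) \<noteq> 0"
    by (auto simp: dual_gp_def Let_def mult_eq_0 split: if_splits)
  then show "B \<subseteq> {1..n} \<and> {1..n} - B \<in> bases \<mu>"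
    unfolding bases_def xs(2) by (auto intro!: exI[of _ "sorted_list_of_set ({1..n} - set xs)"])
next
  assume B: "B \<subseteq> {1..n} \<and> {1..n} - B \<in> bases \<mu>"
  then obtain zs where zs: "\<mu> zs \<noteq> 0" "{1..n} - B = set zs" unfolding bases_def by blast
  define xs where "xs = sorted_list_of_set B"
  have fB: "finite B" using B finite_subset by blast
  then have xs: "distinct xs" "set xs = B" unfolding xs_def by auto
  have d: "distinct (xs @ zs)" "set (xs @ zs) = {1..n}"
    using xs zs(2) gp_support(3)[OF gp zs(1)] B by auto
  have "dual_gp \<tau> n \<mu> xs \<noteq> 0"
    unfolding dual_gp_eq[OF gp_alternating[OF gp] d]
    using esign_nonzero[OF d] zs(1) by (simp add: mult_eq_0)
  then show "B \<in> bases (dual_gp \<tau> n \<mu>)" unfolding bases_def using xs(2) by blast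
qed

text \<open>The vector comes from some \<open>y0 # ys\<close> with \<open>ys\<close> a dual basis.
  If \<open>xs\<close> lists the remaining elements, then \<open>y0 # xs\<close> lists the
  complement of that basis, so \<open>\<mu>\<close> is nonzero on it.\<close>

lemma dual_circuit_vector_form:
  assumes gp: "gp_function n r \<mu>" and C: "circuit n (dual_gp \<tau> n \<mu>) C"
    and X: "circuit_vector (dual_gp \<tau> n \<mu>) C X"
  obtains c e xs where "c \<noteq> 0" "\<mu> (e # xs) \<noteq> 0" "X = (\<lambda>e. c * \<tau> (\<mu> (e # xs)))"
proof -
  obtain y0 ys where ys: "distinct (y0 # ys)" "y0 \<in> {1..n}" "set ys \<in> bases (dual_gp \<tau> n \<mu>)"
    "elim_vector (dual_gp \<tau> n \<mu>) (y0 # ys) X"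
    using circuit_vectorE[OF C X] .
  have b: "set ys \<subseteq> {1..n}" "{1..n} - set ys \<in> bases \<mu>"
    using ys(3) bases_dual_gp[OF gp] by auto
  define xs where "xs = sorted_list_of_set ({1..n} - set (y0 # ys))"
  have xs: "distinct xs" "set xs = {1..n} - set (y0 # ys)" unfolding xs_def by auto
  have d: "distinct ((y0 # ys) @ xs)" "set ((y0 # ys) @ xs) = {1..n}"
    using xs ys(1,2) b(1) by auto
  obtain zs where zs: "\<mu> zs \<noteq> 0" "{1..n} - set ys = set zs" using b(2) unfolding bases_def by blast
  have "set (y0 # xs) = insert y0 ({1..n} - insert y0 (set ys))" by (simp add: xs(2))
  also have "\<dots> = {1..n} - set ys" using ys(1,2) by auto
  finally have "set (y0 # xs) = {1..n} - set ys" .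
  then have "\<mu> (y0 # xs) \<noteq> 0"
    using gp_perm[OF gp zs(1), of "y0 # xs"] xs zs(2) by simp
  then show thesis
    using that[OF _ _ dual_elim_vector[OF gp d ys(4)]] esign_nonzero[OF d]
    by (simp add: mult_eq_0)
qed

text \<open>Elimination runs along \<open>e # ls\<close>, where \<open>ls\<close> lists the
  complement of the basis \<open>e # xs\<close>. That the support is a dual circuit is derived from
  the Pluecker relations of \<open>\<mu>\<close>.\<close>

lemma dual_circuit_vector_exists:
  assumes gp: "gp_function n r \<mu>" and nz: "\<mu> (e # xs) \<noteq> 0"
  obtains c C X where "c \<noteq> 0" "circuit n (dual_gp \<tau> n \<mu>) C" "circuit_vector (dual_gp \<tau> n \<mu>) C X"
    "X = (\<lambda>e. c * \<tau> (\<mu> (e # xs)))"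
proof -
  let ?\<psi> = "dual_gp \<tau> n \<mu>"
  have ex: "distinct (e # xs)" "set (e # xs) \<subseteq> {1..n}" "Suc (length xs) = r"
    using gp_support[OF gp nz] by auto
  define ls where "ls = sorted_list_of_set ({1..n} - set (e # xs))"
  have ls: "distinct ls" "set ls = {1..n} - set (e # xs)" unfolding ls_def by auto
  have d: "distinct ((e # ls) @ xs)" "set ((e # ls) @ xs) = {1..n}" using ex ls by auto
  obtain X where X: "elim_vector ?\<psi> (e # ls) X"
    using ex_elim_vector[of "e # ls"] d(1) by auto
  define c :: 'a where "c = eps ^ (length (e # ls) - 1) * esign n ((e # ls) @ xs)"
  have c: "c \<noteq> 0" unfolding c_def using esign_nonzero[OF d] by (simp add: mult_eq_0)
  have Xeq: "X = (\<lambda>e. c * \<tau> (\<mu> (e # xs)))"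
    unfolding c_def by (rule dual_elim_vector[OF gp d X])
  have X0: "X a \<noteq> 0 \<longleftrightarrow> \<mu> (a # xs) \<noteq> 0" for a
    unfolding Xeq using c by (simp add: mult_eq_0)
  let ?D = "{a. X a \<noteq> 0}"
  have D: "a \<in> {1..n}" "a \<notin> set xs" if "a \<in> ?D" for a
    using gp_support(2,3)[OF gp, of "a # xs"] that X0[of a] by auto
  \<comment> \<open>An element of the support completes \<open>xs\<close> to a basis, whose
    complement is a basis of the dual.\<close>
  have coind: "{1..n} - set (a # xs) \<in> bases ?\<psi>" if "a \<in> ?D" for a
  proof -
    have "\<mu> (a # xs) \<noteq> 0" using that X0 by blast
    then have "set (a # xs) \<in> bases \<mu>" "set (a # xs) \<subseteq> {1..n}"
      using gp_support(2)[OF gp] unfolding bases_def by blast+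
    then show ?thesis unfolding bases_dual_gp[OF gp] by (metis Diff_subset double_diff order_refl)
  qed
  have "circuit_vector ?\<psi> ?D X"
    using circuit_vectorI[OF X ls(1)] coind[of e] X0[of e] nz ls(2) by simp
  moreover have "circuit n ?\<psi> ?D"
    unfolding circuit_def
  proof (intro conjI allI impI)
    show "?D \<subseteq> {1..n}" using D(1) by blast
    show "\<not> indep ?\<psi> ?D"
    proof
      assume "indep ?\<psi> ?D"
      then obtain B where B: "?D \<subseteq> B" "{1..n} - B \<in> bases \<mu>"
        unfolding indep_def using bases_dual_gp[OF gp] by blast
      then obtain ws where ws: "\<mu> ws \<noteq> 0" "{1..n} - B = set ws" unfolding bases_def by blast
      let ?l = "e # ws"
      let ?f = "\<lambda>k. eps ^ k * \<mu> (del_nth (k - 1) ?l) * \<mu> (?l ! (k - 1) # xs)"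
      \<comment> \<open>Entries of \<open>ws\<close> lie outside \<open>B\<close>, hence outside the
        support \<open>?D\<close>; only the term deleting \<open>e\<close> survives.\<close>
      have "?f k = 0" if k: "k \<in> {1..length ?l}" "k \<noteq> 1" for k
      proof -
        obtain m where m: "k = Suc (Suc m)" "m < length ws"
          using k by (cases k; cases "k - 1") auto
        then have "ws ! m \<notin> B" using ws(2) by (metis DiffD2 nth_mem)
        then have "\<mu> (ws ! m # xs) = 0" using B(1) X0[of "ws ! m"] by auto
        then show ?thesis using m by simp
      qed
      moreover have "?f 1 \<noteq> 0" using nz ws(1) eps_props(1) by (simp add: del_nth_def mult_eq_0)
      ultimately have "fsum ?f {1..length ?l} \<notin> nullset"
        by (intro fsum_single_notin_nullset[where p = 1]) auto
      moreover have "?l \<in> tuples n (Suc r)"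
        using ex(2) gp_support[OF gp ws(1)] by (simp add: tuples_def)
      moreover have "set xs \<subseteq> {1..n}" using ex(2) by simp
      ultimately show False
        using gp_relation[OF gp _ ex(3)] unfolding plucker_sum_def by blast
    qed
    show "indep ?\<psi> A" if A: "A \<subset> ?D" for A
    proof -
      obtain a where a: "a \<in> ?D" "a \<notin> A" using A by blast
      have "A \<subseteq> {1..n} - set (a # xs)" using D A a(2) by auto
      then show ?thesis using coind[OF a(1)] unfolding indep_def by blast
    qed
  qed
  ultimately show thesis using that c Xeq by blast
qed

text \<open>A scalar \<open>b\<close> on the dual side is the scalar \<open>\<tau> b\<close> on the
  original side, which \<open>M\<close> absorbs.\<close>

lemma F_dual_eq:
  assumes "F_matroid n M"
  shows "F_dual \<tau> n M = dual_gp \<tau> n ` M"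
proof
  show "F_dual \<tau> n M \<subseteq> dual_gp \<tau> n ` M"
  proof
    fix \<psi> assume "\<psi> \<in> F_dual \<tau> n M"
    then obtain \<phi> b where \<phi>: "\<phi> \<in> M" "b \<noteq> 0" "\<psi> = (\<lambda>xs. b * dual_gp \<tau> n \<phi> xs)"
      unfolding F_dual_def gp_class_def by blast
    have "\<psi> = dual_gp \<tau> n (\<lambda>xs. \<tau> b * \<phi> xs)"
      unfolding \<phi>(3) by (auto simp: dual_gp_def Let_def mult_ac)
    then show "\<psi> \<in> dual_gp \<tau> n ` M"
      using F_matroid_scale[OF assms \<phi>(1), of "\<tau> b"] \<phi>(2) by auto
  qed
  show "dual_gp \<tau> n ` M \<subseteq> F_dual \<tau> n M"
    unfolding F_dual_def gp_class_def using zero_neq_one by (force intro!: exI[of _ 1])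
qed

text \<open>This removes the dual from the later arguments: up to a scalar and
  \<open>\<tau>\<close>, a cocircuit is a nonzero slice of \<open>\<mu>\<close> in its first
  argument.\<close>

lemma F_cocircuits_eq:
  assumes M: "F_matroid n M"
  shows "F_cocircuits \<tau> n M =
    {\<lambda>e. c * \<tau> (\<mu> (e # xs)) | c \<mu> xs. c \<noteq> 0 \<and> \<mu> \<in> M \<and> (\<exists>e. \<mu> (e # xs) \<noteq> 0)}" (is "_ = ?R")
proof
  show "F_cocircuits \<tau> n M \<subseteq> ?R"
  proof
    fix Y assume "Y \<in> F_cocircuits \<tau> n M"
    then obtain a X \<mu> C where *: "Y = (\<lambda>i. a * X i)" "a \<noteq> 0" "\<mu> \<in> M"
      "circuit n (dual_gp \<tau> n \<mu>) C" "circuit_vector (dual_gp \<tau> n \<mu>) C X"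
      unfolding F_cocircuits_def F_circuits_def F_dual_eq[OF M] by blast
    obtain c e xs where c: "c \<noteq> 0" "\<mu> (e # xs) \<noteq> 0" "X = (\<lambda>e. c * \<tau> (\<mu> (e # xs)))"
      using dual_circuit_vector_form[OF F_matroid_gp[OF M *(3)] *(4,5)] .
    have "Y = (\<lambda>e. (a * c) * \<tau> (\<mu> (e # xs)))" unfolding *(1) c(3) by (simp add: mult.assoc)
    then show "Y \<in> ?R" using mult_nonzero[OF *(2) c(1)] *(3) c(2) by blast
  qed
  show "?R \<subseteq> F_cocircuits \<tau> n M"
  proof
    fix Y assume "Y \<in> ?R"
    then obtain c \<mu> xs e where *: "Y = (\<lambda>e. c * \<tau> (\<mu> (e # xs)))" "c \<noteq> 0" "\<mu> \<in> M" "\<mu> (e # xs) \<noteq> 0"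
      by blast
    obtain b C X where b: "b \<noteq> 0" "circuit n (dual_gp \<tau> n \<mu>) C"
      "circuit_vector (dual_gp \<tau> n \<mu>) C X" "X = (\<lambda>e. b * \<tau> (\<mu> (e # xs)))"
      using dual_circuit_vector_exists[OF F_matroid_gp[OF M *(3)] *(4)] .
    \<comment> \<open>The inverse \<open>b'\<close> cancels the scalar produced by the elimination,
      so that the prescribed factor \<open>c\<close> is reached.\<close>
    obtain b' where b': "b * b' = 1" using ex_inverse[OF b(1)] by blast
    then have "b' \<noteq> 0" by (metis mult_zero_right zero_neq_one)
    then have "c * b' \<noteq> 0" using mult_nonzero[OF *(2)] by blast
    moreover have "Y = (\<lambda>i. (c * b') * X i)"
    proof
      fix i
      have "(c * b') * X i = (b * b') * Y i" unfolding *(1) b(4) by (simp add: mult_ac)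
      then show "Y i = (c * b') * X i" using b' by simp
    qed
    ultimately show "Y \<in> F_cocircuits \<tau> n M"
      unfolding F_cocircuits_def F_circuits_def F_dual_eq[OF M] using b(2,3) *(3) by blast
  qed
qed

section \<open>Quotients as orthogonality\<close>

text \<open>Both directions translate through \<open>plucker_sum_iff_orth\<close>. For the converse,
  tuples with repetitions and sums without nonzero terms are null by themselves; each remaining sum
  comes from a circuit of \<open>N\<close> and a cocircuit of \<open>M\<close>.\<close>

lemma F_quotient_iff_orth:
  assumes N: "F_matroid n N" and M: "F_matroid n M"
  shows "F_quotient n N M \<longleftrightarrow>
    (\<forall>X\<in>F_circuits n N. \<forall>Y\<in>F_cocircuits \<tau> n M. orth \<tau> n X Y)"
proof (intro iffI ballI)
  fix X Y assume Q: "F_quotient n N M" and X: "X \<in> F_circuits n N" and Y: "Y \<in> F_cocircuits \<tau> n M"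
  obtain a Z \<nu> C where Z: "X = (\<lambda>i. a * Z i)" "a \<noteq> 0" "\<nu> \<in> N" "circuit n \<nu> C" "circuit_vector \<nu> C Z"
    using X unfolding F_circuits_def by blast
  obtain c \<mu> xs e where \<mu>: "Y = (\<lambda>e. c * \<tau> (\<mu> (e # xs)))" "c \<noteq> 0" "\<mu> \<in> M" "\<mu> (e # xs) \<noteq> 0"
    using Y unfolding F_cocircuits_eq[OF M] by blast
  obtain y0 ys where ys: "distinct (y0 # ys)" "y0 \<in> {1..n}" "set ys \<in> bases \<nu>"
    "elim_vector \<nu> (y0 # ys) Z"
    using circuit_vectorE[OF Z(4,5)] .
  obtain zs where zs: "\<nu> zs \<noteq> 0" "set ys = set zs" using ys(3) unfolding bases_def by blast
  have "\<nu> ys \<noteq> 0" using gp_perm[OF F_matroid_gp[OF N Z(3)] zs(1) _ zs(2)] ys(1) by simp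
  then have l: "y0 # ys \<in> tuples n (Suc (mrank N))"
    using gp_support[OF F_matroid_gp[OF N Z(3)]] ys(2) by (auto simp: tuples_def)
  have "Suc (length xs) = mrank M" "set xs \<subseteq> {1..n}"
    using gp_support[OF F_matroid_gp[OF M \<mu>(3)] \<mu>(4)] by auto
  then have "plucker_sum \<nu> \<mu> (y0 # ys) xs \<in> nullset"
    using Q l Z(3) \<mu>(3) unfolding F_quotient_def by blast
  then have "orth \<tau> n Z (\<lambda>e. \<tau> (\<mu> (e # xs)))"
    using plucker_sum_iff_orth[OF inv ys(4,1)] l unfolding tuples_def by blast
  then show "orth \<tau> n X Y"
    unfolding Z(1) \<mu>(1) orth_scale_left[OF inv Z(2)] orth_scale_right[OF inv \<mu>(2)] .
next
  assume O: "\<forall>X\<in>F_circuits n N. \<forall>Y\<in>F_cocircuits \<tau> n M. orth \<tau> n X Y"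
  show "F_quotient n N M"
    unfolding F_quotient_def
  proof (intro ballI allI impI)
    fix \<nu> \<mu> ys xs
    assume \<nu>: "\<nu> \<in> N" and \<mu>: "\<mu> \<in> M" and ys: "ys \<in> tuples n (Suc (mrank N))"
    have gp: "gp_function n (mrank N) \<nu>" using F_matroid_gp[OF N \<nu>] .
    show "plucker_sum \<nu> \<mu> ys xs \<in> nullset"
    proof (cases "distinct ys")
      case False
      then show ?thesis using plucker_sum_not_distinct[OF gp] by blast
    next
      case d: True
      let ?f = "\<lambda>k. eps ^ k * \<nu> (del_nth (k - 1) ys) * \<mu> (ys ! (k - 1) # xs)"
      show ?thesis
      proof (cases "\<exists>k\<in>{1..length ys}. ?f k \<noteq> 0")
        case False
        then have "plucker_sum \<nu> \<mu> ys xs = {#}"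
          unfolding plucker_sum_def by (intro fsum_zero) blast
        then show ?thesis by (simp add: empty_in_nullset)
      next
        case True
        \<comment> \<open>A nonzero term supplies both vectors: deleting \<open>y0\<close> leaves a
          basis of \<open>N\<close>, so elimination gives a circuit, and \<open>y0 # xs\<close> is a
          basis of \<open>M\<close>, so the slice at \<open>xs\<close> gives a cocircuit.\<close>
        then obtain k where k: "k \<in> {1..length ys}" "?f k \<noteq> 0" by blast
        define y0 us vs where "y0 = ys ! (k - 1)" and "us = take (k - 1) ys" and "vs = drop k ys"
        have uv: "ys = us @ y0 # vs"
          unfolding y0_def us_def vs_def using k(1) id_take_nth_drop[of "k - 1" ys]
          by (cases k) auto
        have nz: "\<nu> (us @ vs) \<noteq> 0" "\<mu> (y0 # xs) \<noteq> 0"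
          using k unfolding us_def vs_def y0_def by (auto simp: del_nth_def mult_eq_0)
        have d': "distinct (y0 # us @ vs)" "y0 \<in> {1..n}"
          using d ys unfolding uv tuples_def by auto
        obtain X where X: "elim_vector \<nu> (y0 # us @ vs) X" using ex_elim_vector[OF d'(1)] by blast
        have one: "(1::'a) \<noteq> 0" by simp
        have "(\<lambda>i. 1 * X i) \<in> F_circuits n N"
          unfolding F_circuits_def using elim_vector_circuit[OF gp X d' nz(1)] \<nu> one by blast
        moreover have "(\<lambda>e. 1 * \<tau> (\<mu> (e # xs))) \<in> F_cocircuits \<tau> n M"
          unfolding F_cocircuits_eq[OF M] using \<mu> nz(2) one by blast
        ultimately have "orth \<tau> n (\<lambda>i. 1 * X i) (\<lambda>e. 1 * \<tau> (\<mu> (e # xs)))" using O by blast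
        then have "orth \<tau> n X (\<lambda>e. \<tau> (\<mu> (e # xs)))" by simp
        \<comment> \<open>The circuit was built with \<open>y0\<close> in front; this sign moves
          \<open>y0\<close> back to its place in \<open>ys\<close>.\<close>
        then have "orth \<tau> n (\<lambda>i. eps ^ length us * X i) (\<lambda>e. \<tau> (\<mu> (e # xs)))"
          using orth_scale_left[OF inv eps_power_nonzero] by blast
        moreover have "elim_vector \<nu> ys (\<lambda>e. eps ^ length us * X e)"
          unfolding uv by (rule elim_vector_move[OF gp_alternating[OF gp] X d'(1)])
        ultimately show ?thesis
          using plucker_sum_iff_orth[OF inv _ d] ys unfolding tuples_def by blast
      qed
    qed
  qed
qed

text \<open>All representatives of \<open>M\<close> are multiples of one function, whose own
  Pluecker relations give the claim.\<close>

lemma F_quotient_refl: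
  assumes M: "F_matroid n M"
  shows "F_quotient n M M"
proof -
  obtain r \<phi> where \<phi>: "gp_function n r \<phi>" "M = gp_class \<phi>"
    using M unfolding F_matroid_def by blast
  show ?thesis
    unfolding F_quotient_def
  proof (intro ballI allI impI)
    fix \<nu> \<mu> ys xs
    assume *: "\<nu> \<in> M" "\<mu> \<in> M" "ys \<in> tuples n (Suc (mrank M))"
      "Suc (length xs) = mrank M \<and> set xs \<subseteq> {1..n}"
    obtain a b where ab: "a \<noteq> 0" "\<nu> = (\<lambda>xs. a * \<phi> xs)" "b \<noteq> 0" "\<mu> = (\<lambda>xs. b * \<phi> xs)"
      using *(1,2) unfolding \<phi>(2) gp_class_def by blast
    show "plucker_sum \<nu> \<mu> ys xs \<in> nullset"
      unfolding ab(2,4) plucker_sum_scale[OF ab(1,3)]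
      using gp_relation[OF \<phi>(1)] *(3,4) mrank_gp_class[OF \<phi>(1)] \<phi>(2) by simp
  qed
qed

section \<open>Circuits as vectors, cocircuits as covectors\<close>

text \<open>Supplies the support condition of \<open>perp\<close> when circuits of \<open>N\<close>
  are taken as vectors of \<open>M\<close>.\<close>

lemma F_circuits_off:
  assumes N: "F_matroid n N" and X: "X \<in> F_circuits n N" and i: "i \<notin> {1..n}"
  shows "X i = 0"
proof -
  obtain a Z \<nu> C where Z: "X = (\<lambda>i. a * Z i)" "\<nu> \<in> N" "circuit n \<nu> C" "circuit_vector \<nu> C Z"
    using X unfolding F_circuits_def by blast
  have "i \<notin> C" using Z(3) i unfolding circuit_def by blast
  then show ?thesis
    using circuit_vector_off[OF F_matroid_gp[OF N Z(2)] Z(3,4)] by (simp add: Z(1))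
qed

lemma F_cocircuits_off:
  assumes M: "F_matroid n M" and Y: "Y \<in> F_cocircuits \<tau> n M" and i: "i \<notin> {1..n}"
  shows "Y i = 0"
proof -
  obtain c \<mu> xs where \<mu>: "Y = (\<lambda>e. c * \<tau> (\<mu> (e # xs)))" "\<mu> \<in> M"
    using Y unfolding F_cocircuits_eq[OF M] by blast
  have "\<mu> (i # xs) = 0" using gp_support(2)[OF F_matroid_gp[OF M \<mu>(2)], of "i # xs"] i by auto
  then show ?thesis by (simp add: \<mu>(1))
qed

text \<open>The orthogonality criterion is applied with both matroids equal to \<open>M\<close>,
  where the quotient relation is reflexivity.\<close>

lemma F_cocircuits_subset_F_covectors:
  assumes "F_matroid n M"
  shows "F_cocircuits \<tau> n M \<subseteq> F_covectors \<tau> n M"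
proof
  fix Y assume Y: "Y \<in> F_cocircuits \<tau> n M"
  have "orth \<tau> n Y X" if "X \<in> F_circuits n M" for X
    using F_quotient_refl[OF assms] that Y orth_commute[OF inv, of n X Y]
    unfolding F_quotient_iff_orth[OF assms assms] by blast
  then show "Y \<in> F_covectors \<tau> n M"
    unfolding F_covectors_def perp_def using F_cocircuits_off[OF assms Y] by blast
qed

lemma F_quotient_if_F_covectors_subset:
  assumes N: "F_matroid n N" and M: "F_matroid n M"
    and sub: "F_covectors \<tau> n M \<subseteq> F_covectors \<tau> n N"
  shows "F_quotient n N M"
  unfolding F_quotient_iff_orth[OF N M]
proof (intro ballI)
  fix X Y assume X: "X \<in> F_circuits n N" and Y: "Y \<in> F_cocircuits \<tau> n M"
  have "Y \<in> F_covectors \<tau> n N" using Y F_cocircuits_subset_F_covectors[OF M] sub by blast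
  then have "orth \<tau> n Y X" using X unfolding F_covectors_def perp_def by blast
  then show "orth \<tau> n X Y" using orth_commute[OF inv] by blast
qed

text \<open>By the criterion the circuits of \<open>N\<close> are vectors of \<open>M\<close>;
  perfection, applied to \<open>M\<close>, makes them orthogonal to each \<open>W\<close>.\<close>

lemma F_covectors_subset_if_F_quotient:
  assumes N: "F_matroid n N" and M: "F_matroid n M"
    and perfect: "perfect_tract \<tau>" and Q: "F_quotient n N M"
  shows "F_covectors \<tau> n M \<subseteq> F_covectors \<tau> n N"
proof
  fix W assume W: "W \<in> F_covectors \<tau> n M"
  have "orth \<tau> n W X" if X: "X \<in> F_circuits n N" for X
  proof -
    have "X \<in> F_vectors \<tau> n M"
      using Q X F_circuits_off[OF N X]
      unfolding F_quotient_iff_orth[OF N M] F_vectors_def perp_def by blast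
    then have "orth \<tau> n X W" using perfect M W unfolding perfect_tract_def by blast
    then show ?thesis using orth_commute[OF inv] by blast
  qed
  then show "W \<in> F_covectors \<tau> n N" using W unfolding F_covectors_def perp_def by blast
qed

end

section \<open>Chains of matroids\<close>

theorem theorem2p16:
  fixes \<tau> :: "'a::tract \<Rightarrow> 'a"
    and M :: "nat \<Rightarrow> (nat list \<Rightarrow> 'a) set"
    and n s :: nat
  assumes "tract_involution \<tau>"
    and "\<And>i. 1 \<le> i \<Longrightarrow> i \<le> s \<Longrightarrow> F_matroid n (M i)"
  shows "((\<forall>i. 1 \<le> i \<and> i < s \<longrightarrow> F_covectors \<tau> n (M i) \<subseteq> F_covectors \<tau> n (M (i + 1)))
            \<longrightarrow> (\<forall>i j. 1 \<le> i \<and> i < j \<and> j \<le> s \<longrightarrow> F_quotient n (M j) (M i)))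
       \<and> ((\<forall>i j. 1 \<le> i \<and> i < j \<and> j \<le> s \<longrightarrow> F_quotient n (M j) (M i))
            \<longrightarrow> (\<forall>i. 1 \<le> i \<and> i < s \<longrightarrow> F_quotient n (M (i + 1)) (M i)))
       \<and> (perfect_tract \<tau>
            \<longrightarrow> (\<forall>i. 1 \<le> i \<and> i < s \<longrightarrow> F_quotient n (M (i + 1)) (M i))
            \<longrightarrow> (\<forall>i. 1 \<le> i \<and> i < s \<longrightarrow> F_covectors \<tau> n (M i) \<subseteq> F_covectors \<tau> n (M (i + 1))))"
proof (intro conjI impI allI)
  fix i j
  assume chain: "\<forall>i. 1 \<le> i \<and> i < s \<longrightarrow> F_covectors \<tau> n (M i) \<subseteq> F_covectors \<tau> n (M (i + 1))"
    and ij: "1 \<le> i \<and> i < j \<and> j \<le> s"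
  have "i \<le> j" using ij by simp
  \<comment> \<open>Neighbouring inclusions compose. The bound on \<open>j\<close> stays inside the
    induction statement because \<open>chain\<close> reaches only up to \<open>s\<close>.\<close>
  then have "j \<le> s \<longrightarrow> F_covectors \<tau> n (M i) \<subseteq> F_covectors \<tau> n (M j)"
  proof (induction j rule: dec_induct)
    case (step m)
    have "F_covectors \<tau> n (M m) \<subseteq> F_covectors \<tau> n (M (Suc m))" if "Suc m \<le> s"
      using chain[rule_format, of m] step.hyps ij that by simp
    then show ?case using step.IH by force
  qed simp
  then have "F_covectors \<tau> n (M i) \<subseteq> F_covectors \<tau> n (M j)" using ij by blast
  then show "F_quotient n (M j) (M i)"
    using ij assms(2) by (intro F_quotient_if_F_covectors_subset[OF assms(1)]) auto
next
  fix i
  assume "\<forall>i j. 1 \<le> i \<and> i < j \<and> j \<le> s \<longrightarrow> F_quotient n (M j) (M i)" "1 \<le> i \<and> i < s"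
  then show "F_quotient n (M (i + 1)) (M i)" by auto
next
  fix i
  assume "perfect_tract \<tau>" "\<forall>i. 1 \<le> i \<and> i < s \<longrightarrow> F_quotient n (M (i + 1)) (M i)" "1 \<le> i \<and> i < s"
  then show "F_covectors \<tau> n (M i) \<subseteq> F_covectors \<tau> n (M (i + 1))"
    using assms(2) by (intro F_covectors_subset_if_F_quotient[OF assms(1)]) auto
qed

end
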